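(* Let $M$ be a connected non-bipartite binary matroid. The following are equivalent: (i) $M$ is odd-$C_3^+$-free; (ii) $M$ has a totally odd circuit basis; (iii) every odd cycle basis of $M$ is totally odd.
   Context: Matroids are loopless. A matroid is binary if representable over $\mathbb{F}_2$; connected if it has at least two elements and any two distinct elements lie in a common circuit; bipartite if all its circuits have even cardinality. A cycle is a union of disjoint circuits, odd if it has an odd number of elements. For binary $M$ with ground set $S$, the cycles' incidence vectors form a subspace $\mathcal{C}(M)\subseteq\mathbb{F}_2^S$; a cycle basis is a set of cycles whose incidence vectors form a basis of it, a circuit basis is a cycle basis consisting of circuits. A cycle basis is odd if all elements are odd; an odd cycle basis is totally odd if any two of its elements share an odd number of elements. Graphs are finite, may have parallel edges but no loops; a totally odd subdivision of a graph $H$ replaces each edge $e$ by a path with an odd number of edges joining the ends of $e$, paths for distinct edges sharing no inner vertices. $C_3^+$ is the triangle $K_3$ with one edge doubled by a parallel edge; an odd-$C_3^+$ graph is a totally odd subdivision of $C_3^+$. An odd-$C_3^+$ of $M$ is a restriction of $M$ isomorphic to the circuit matroid of an odd-$C_3^+$ graph, and $M$ is odd-$C_3^+$-free if it has none. *)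

theory Defs
  imports "HOL-Library.Z2" "HOL-Library.Function_Algebras"
    "HOL-Library.Indicator_Function" "HOL-Library.Disjoint_Sets"
begin

section \<open>Matroids\<close>

record 'a matroid =
  ground :: "'a set"
  indep :: "'a set \<Rightarrow> bool"

definition is_matroid :: "'a matroid \<Rightarrow> bool" where
  "is_matroid M \<longleftrightarrow>
     finite (ground M) \<and>
     (\<forall>X. indep M X \<longrightarrow> X \<subseteq> ground M) \<and>
     indep M {} \<and>
     (\<forall>X Y. indep M X \<and> Y \<subseteq> X \<longrightarrow> indep M Y) \<and>
     (\<forall>X Y. indep M X \<and> indep M Y \<and> card Y < card X \<longrightarrow>
        (\<exists>x\<in>X - Y. indep M (insert x Y)))"

definition loopless :: "'a matroid \<Rightarrow> bool" where
  "loopless M \<longleftrightarrow> (\<forall>x\<in>ground M. indep M {x})"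

definition circuit :: "'a matroid \<Rightarrow> 'a set \<Rightarrow> bool" where
  "circuit M C \<longleftrightarrow> C \<subseteq> ground M \<and> \<not> indep M C \<and> (\<forall>D. D \<subset> C \<longrightarrow> indep M D)"

definition matroid_connected :: "'a matroid \<Rightarrow> bool" where
  "matroid_connected M \<longleftrightarrow>
     2 \<le> card (ground M) \<and>
     (\<forall>x\<in>ground M. \<forall>y\<in>ground M. x \<noteq> y \<longrightarrow> (\<exists>C. circuit M C \<and> x \<in> C \<and> y \<in> C))"

definition matroid_bipartite :: "'a matroid \<Rightarrow> bool" where
  "matroid_bipartite M \<longleftrightarrow> (\<forall>C. circuit M C \<longrightarrow> even (card C))"

definition restriction :: "'a matroid \<Rightarrow> 'a set \<Rightarrow> 'a matroid" where
  "restriction M X = \<lparr>ground = X, indep = (\<lambda>Y. Y \<subseteq> X \<and> indep M Y)\<rparr>"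

definition matroid_iso :: "'a matroid \<Rightarrow> 'b matroid \<Rightarrow> bool" where
  "matroid_iso M N \<longleftrightarrow>
     (\<exists>f. bij_betw f (ground M) (ground N) \<and>
          (\<forall>X. X \<subseteq> ground M \<longrightarrow> (indep M X \<longleftrightarrow> indep N (f ` X))))"


section \<open>Binary matroids and cycle bases\<close>

interpretation F2: vector_space "\<lambda>(c::bit) (v::'b \<Rightarrow> bit). (\<lambda>i. c * v i)"
  by unfold_locales (auto simp: fun_eq_iff algebra_simps)

text \<open>
  The space \<open>F\<^sub>2\<^sup>n\<close> is rendered as the vectors \<^typ>\<open>nat \<Rightarrow> bit\<close> supported on \<open>{..<n}\<close>.
  The injectivity conjunct expresses that \<open>\<phi>\<close> is independent as a family on \<open>X\<close>, since
  parallel elements may be represented by the same vector.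
\<close>

definition binary :: "'a matroid \<Rightarrow> bool" where
  "binary M \<longleftrightarrow>
     (\<exists>(n::nat) \<phi> :: 'a \<Rightarrow> nat \<Rightarrow> bit.
        (\<forall>x\<in>ground M. \<forall>i\<ge>n. \<phi> x i = 0) \<and>
        (\<forall>X. X \<subseteq> ground M \<longrightarrow> (indep M X \<longleftrightarrow> inj_on \<phi> X \<and> F2.independent (\<phi> ` X))))"

definition matroid_cycle :: "'a matroid \<Rightarrow> 'a set \<Rightarrow> bool" where
  "matroid_cycle M Z \<longleftrightarrow> (\<exists>\<D>. (\<forall>C\<in>\<D>. circuit M C) \<and> disjoint \<D> \<and> Z = \<Union>\<D>)"

definition cycle_space :: "'a matroid \<Rightarrow> ('a \<Rightarrow> bit) set" where
  "cycle_space M = indicator ` {Z. matroid_cycle M Z}"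

definition cycle_basis :: "'a matroid \<Rightarrow> 'a set set \<Rightarrow> bool" where
  "cycle_basis M B \<longleftrightarrow>
     (\<forall>Z\<in>B. matroid_cycle M Z) \<and>
     F2.independent ((indicator :: 'a set \<Rightarrow> 'a \<Rightarrow> bit) ` B) \<and>
     F2.span ((indicator :: 'a set \<Rightarrow> 'a \<Rightarrow> bit) ` B) = cycle_space M"

definition circuit_basis :: "'a matroid \<Rightarrow> 'a set set \<Rightarrow> bool" where
  "circuit_basis M B \<longleftrightarrow> cycle_basis M B \<and> (\<forall>C\<in>B. circuit M C)"

definition odd_cycle_basis :: "'a matroid \<Rightarrow> 'a set set \<Rightarrow> bool" where
  "odd_cycle_basis M B \<longleftrightarrow> cycle_basis M B \<and> (\<forall>Z\<in>B. odd (card Z))"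

definition totally_odd_cycle_basis :: "'a matroid \<Rightarrow> 'a set set \<Rightarrow> bool" where
  "totally_odd_cycle_basis M B \<longleftrightarrow>
     odd_cycle_basis M B \<and> (\<forall>Y\<in>B. \<forall>Z\<in>B. Y \<noteq> Z \<longrightarrow> odd (card (Y \<inter> Z)))"


section \<open>Graphs and totally odd subdivisions\<close>

record ('v, 'e) graph =
  verts :: "'v set"
  edges :: "'e set"
  ends :: "'e \<Rightarrow> 'v set"

definition is_graph :: "('v, 'e) graph \<Rightarrow> bool" where
  "is_graph G \<longleftrightarrow> finite (verts G) \<and> finite (edges G) \<and>
     (\<forall>e\<in>edges G. ends G e \<subseteq> verts G \<and> card (ends G e) = 2)"

definition is_path :: "('v, 'e) graph \<Rightarrow> 'v list \<Rightarrow> 'e list \<Rightarrow> bool" where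
  "is_path G vs es \<longleftrightarrow>
     length vs = Suc (length es) \<and> distinct vs \<and> set vs \<subseteq> verts G \<and> set es \<subseteq> edges G \<and>
     (\<forall>i<length es. ends G (es ! i) = {vs ! i, vs ! Suc i})"

definition inner_verts :: "'v list \<Rightarrow> 'v set" where
  "inner_verts vs = set (butlast (tl vs))"

text \<open>
  Two parallel edges form a graph cycle of length 2; requiring \<open>es\<close> to be distinct rules out
  traversing a single edge back and forth.
\<close>

definition graph_cycle :: "('v, 'e) graph \<Rightarrow> 'e set \<Rightarrow> bool" where
  "graph_cycle G C \<longleftrightarrow>
     (\<exists>vs es. 2 \<le> length es \<and> length vs = length es \<and> distinct vs \<and> distinct es \<and>
        set vs \<subseteq> verts G \<and> set es \<subseteq> edges G \<and>
        (\<forall>i<length es. ends G (es ! i) = {vs ! i, vs ! (Suc i mod length es)}) \<and>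
        C = set es)"

definition circuit_matroid :: "('v, 'e) graph \<Rightarrow> 'e matroid" where
  "circuit_matroid G =
     \<lparr>ground = edges G,
      indep = (\<lambda>F. F \<subseteq> edges G \<and> (\<forall>C. C \<subseteq> F \<longrightarrow> \<not> graph_cycle G C))\<rparr>"

text \<open>
  Here \<open>f\<close> embeds the vertices of \<open>H\<close> as branch vertices of \<open>G\<close>, and the edge \<open>e\<close> of \<open>H\<close> is
  replaced by the path with vertex sequence \<open>P e\<close> and edge sequence \<open>Q e\<close>. Disjointness of the
  edge sequences is not implied by that of the inner vertices: parallel edges of \<open>H\<close> could
  otherwise be replaced by the same single edge.
\<close>

definition totally_odd_subdivision :: "('v, 'e) graph \<Rightarrow> ('w, 'd) graph \<Rightarrow> bool" where
  "totally_odd_subdivision H G \<longleftrightarrow>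
     is_graph G \<and>
     (\<exists>f P Q.
        inj_on f (verts H) \<and>
        (\<forall>e\<in>edges H. is_path G (P e) (Q e) \<and> odd (length (Q e)) \<and>
            {hd (P e), last (P e)} = f ` ends H e \<and>
            inner_verts (P e) \<inter> f ` verts H = {}) \<and>
        (\<forall>e\<in>edges H. \<forall>e'\<in>edges H. e \<noteq> e' \<longrightarrow>
            inner_verts (P e) \<inter> inner_verts (P e') = {} \<and> set (Q e) \<inter> set (Q e') = {}) \<and>
        verts G = f ` verts H \<union> (\<Union>e\<in>edges H. inner_verts (P e)) \<and>
        edges G = (\<Union>e\<in>edges H. set (Q e)))"

definition C3_plus :: "(nat, nat) graph" where
  "C3_plus = \<lparr>verts = {0, 1, 2}, edges = {0, 1, 2, 3},
              ends = (\<lambda>e. [{0, 1}, {1, 2}, {2, 0}, {0, 1}] ! e)\<rparr>"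

text \<open>
  Graphs are finite, so up to isomorphism it suffices to let the vertices and edges of an
  odd-\<open>C\<^sub>3\<^sup>+\<close> graph range over the natural numbers.
\<close>

definition odd_C3_plus_graph :: "(nat, nat) graph \<Rightarrow> bool" where
  "odd_C3_plus_graph G \<longleftrightarrow> totally_odd_subdivision C3_plus G"

definition odd_C3_plus_free :: "'a matroid \<Rightarrow> bool" where
  "odd_C3_plus_free M \<longleftrightarrow>
     \<not> (\<exists>X G. X \<subseteq> ground M \<and> odd_C3_plus_graph G \<and>
           matroid_iso (restriction M X) (circuit_matroid G))"

end

theory Submission
  imports Defs "HOL-Library.Nat_Bijection"
begin

text \<open>
  Parity of \<open>X \<inter> Y\<close> is a bilinear form on the cycle space and parity of \<open>X\<close> is a linear form, so an
  odd cycle basis is totally odd iff (P) \<open>|X \<inter> Y| \<equiv> |X| |Y|\<close> modulo 2 for all cycles \<open>X\<close>, \<open>Y\<close>; in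
  particular this does not depend on the basis. An odd-\<open>C\<^sub>3\<^sup>+\<close> consists of two odd circuits whose
  union contains only one further circuit and which meet in a nonempty even set, so it violates (P).

  Conversely, build \<open>M\<close> from an odd circuit by successively adding ears. Given an odd circuit \<open>C\<close>
  and an element \<open>e\<close> outside it, a circuit through \<open>e\<close> meeting \<open>C\<close> and leaving \<open>C\<close> in as few
  elements as possible forms a theta with \<open>C\<close>; of the two circuits of the theta through \<open>e\<close> one is
  odd. Hence each ear lies in an odd circuit, which yields an odd circuit basis, and if there is no
  odd-\<open>C\<^sub>3\<^sup>+\<close> then (P) survives each ear.
\<close>

section \<open>Families closed under symmetric difference\<close>

lemma even_card_sym_diff:
  assumes "finite X" "finite Y"
  shows "even (card (sym_diff X Y)) \<longleftrightarrow> (even (card X) \<longleftrightarrow> even (card Y))"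
proof -
  have "card X = card (X - Y) + card (X \<inter> Y)" "card Y = card (Y - X) + card (X \<inter> Y)"
    using assms by (metis Int_commute card_Diff_subset_Int card_Int_Diff add.commute finite_Int)+
  moreover have "card (sym_diff X Y) = card (X - Y) + card (Y - X)"
    using assms by (intro card_Un_disjoint) auto
  ultimately show ?thesis by presburger
qed

lemma even_card_Int_sym_diff:
  assumes "finite Z"
  shows "even (card (Z \<inter> sym_diff X Y)) \<longleftrightarrow> (even (card (Z \<inter> X)) \<longleftrightarrow> even (card (Z \<inter> Y)))"
proof -
  have "Z \<inter> sym_diff X Y = sym_diff (Z \<inter> X) (Z \<inter> Y)" by auto
  then show ?thesis using even_card_sym_diff[of "Z \<inter> X" "Z \<inter> Y"] assms by simp
qed

text \<open>This is the span over F_2 in the language of sets, where adding incidence vectors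
  becomes symmetric difference. One generator is added at a time, so additive properties extend from
  \<open>B\<close> to \<open>gen B\<close> by induction.\<close>

inductive_set gen :: "'a set set \<Rightarrow> 'a set set" for B where
  empty: "{} \<in> gen B"
| step: "X \<in> gen B \<Longrightarrow> Y \<in> B \<Longrightarrow> sym_diff X Y \<in> gen B"

lemma gen_base: "Y \<in> B \<Longrightarrow> Y \<in> gen B"
  using gen.step[OF gen.empty] by fastforce

lemma gen_mono: "X \<in> gen A \<Longrightarrow> A \<subseteq> B \<Longrightarrow> X \<in> gen B"
  by (induction rule: gen.induct) (auto intro: gen.intros)

text \<open>An abstract cycle space: a linear subspace of the power set of \<open>S\<close> over
  F_2. The whole ear argument is carried out at this level, without reference to
  independence.\<close>

locale cycle_family =
  fixes S :: "'a set" and \<C> :: "'a set set"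
  assumes finite_S: "finite S"
    and cycle_subset: "X \<in> \<C> \<Longrightarrow> X \<subseteq> S"
    and empty_cycle: "{} \<in> \<C>"
    and sym_diff_cycle: "X \<in> \<C> \<Longrightarrow> Y \<in> \<C> \<Longrightarrow> sym_diff X Y \<in> \<C>"
begin

definition circ :: "'a set \<Rightarrow> bool" where
  "circ C \<longleftrightarrow> C \<in> \<C> \<and> C \<noteq> {} \<and> (\<forall>D\<in>\<C>. D \<subseteq> C \<longrightarrow> D = {} \<or> D = C)"

text \<open>
  The last clause is not implied by \<open>C\<close>, \<open>D\<close> and \<open>sym_diff C D\<close> being circuits: the three 4-cycles
  of \<open>K\<^sub>4\<close> are a counterexample.
\<close>

definition theta :: "'a set \<Rightarrow> 'a set \<Rightarrow> bool" where
  "theta C D \<longleftrightarrow> circ C \<and> circ D \<and> C \<noteq> D \<and> C \<inter> D \<noteq> {} \<and>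
     (\<forall>X\<in>\<C>. X \<subseteq> C \<union> D \<longrightarrow> X = {} \<or> X = C \<or> X = D \<or> X = sym_diff C D)"

text \<open>Unlike in \<open>matroid_connected\<close>, the circuits must stay inside
  \<open>E\<close>, and the case \<open>x = y\<close> is included, so that every element of
  \<open>E\<close> lies on some circuit.\<close>

definition conn :: "'a set \<Rightarrow> bool" where
  "conn E \<longleftrightarrow> (\<forall>x\<in>E. \<forall>y\<in>E. \<exists>C. circ C \<and> C \<subseteq> E \<and> x \<in> C \<and> y \<in> C)"

definition odd_circs :: "'a set \<Rightarrow> 'a set set" where
  "odd_circs E = {C. circ C \<and> odd (card C) \<and> C \<subseteq> E}"

text \<open>Property (P), relative to the cycles inside \<open>E\<close>, so that it can serve as an
  invariant while ears are added.\<close>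

definition parity_form :: "'a set \<Rightarrow> bool" where
  "parity_form E \<longleftrightarrow> (\<forall>X\<in>\<C>. \<forall>Y\<in>\<C>. X \<subseteq> E \<longrightarrow> Y \<subseteq> E \<longrightarrow>
     (odd (card (X \<inter> Y)) \<longleftrightarrow> odd (card X) \<and> odd (card Y)))"

section \<open>Circuits, ears and thetas\<close>

lemma finite_cycle: "X \<in> \<C> \<Longrightarrow> finite X"
  using cycle_subset finite_S finite_subset by blast

lemma circD: "circ C \<Longrightarrow> C \<in> \<C>" "circ C \<Longrightarrow> C \<noteq> {}"
  "circ C \<Longrightarrow> D \<in> \<C> \<Longrightarrow> D \<subseteq> C \<Longrightarrow> D = {} \<or> D = C"
  by (auto simp: circ_def)

text \<open>If \<open>X\<close> properly contains a nonempty cycle \<open>D\<close>, then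
  \<open>X - D\<close> is a cycle as well, and \<open>x\<close> lies in one of these two smaller
  cycles.\<close>

lemma circ_through:
  assumes "X \<in> \<C>" "x \<in> X"
  shows "\<exists>C. circ C \<and> x \<in> C \<and> C \<subseteq> X"
  using finite_cycle[OF assms(1)] assms
proof (induction X rule: finite_psubset_induct)
  case (psubset X)
  show ?case
  proof (cases "circ X")
    case False
    then obtain D where D: "D \<in> \<C>" "D \<subseteq> X" "D \<noteq> {}" "D \<noteq> X"
      using psubset.prems by (auto simp: circ_def)
    have e: "sym_diff X D = X - D" using D(2) by auto
    have d: "X - D \<in> \<C>" using sym_diff_cycle[OF psubset.prems(1) D(1)] e by simp
    show ?thesis
    proof (cases "x \<in> D")
      case True then show ?thesis using psubset.IH[of D] D by blast
    next
      case False
      have "X - D \<subset> X" using D by auto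
      then show ?thesis using psubset.IH[of "X - D"] d psubset.prems False by blast
    qed
  qed (use psubset.prems in auto)
qed

text \<open>
  Choose \<open>D'\<close> with the fewest elements outside \<open>E\<close>: a cycle meeting \<open>D' - E\<close> properly would
  yield a circuit through \<open>e\<close> that leaves \<open>E\<close> in fewer elements.
\<close>

lemma ear_exists:
  assumes "circ D" "e \<in> D" "e \<notin> E" "D \<inter> E \<noteq> {}"
  shows "\<exists>D'. circ D' \<and> e \<in> D' \<and> D' \<inter> E \<noteq> {} \<and> D' \<subseteq> E \<union> D \<and>
    (\<forall>X\<in>\<C>. X \<subseteq> E \<union> D' \<longrightarrow> X \<subseteq> E \<or> sym_diff X D' \<subseteq> E)"
proof -
  define P where "P D' \<longleftrightarrow> circ D' \<and> e \<in> D' \<and> D' \<inter> E \<noteq> {} \<and> D' \<subseteq> E \<union> D" for D'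
  have "P D" using assms by (auto simp: P_def)
  then obtain D' where D': "P D'" and min: "\<And>D''. P D'' \<Longrightarrow> card (D' - E) \<le> card (D'' - E)"
    using arg_min_nat_lemma[of P D "\<lambda>D. card (D - E)"] by blast
  have c: "circ D'" and eD: "e \<in> D'" and sub: "D' \<subseteq> E \<union> D" using D' by (auto simp: P_def)
  have full: "D' - E \<subseteq> X" if X: "X \<in> \<C>" "X \<subseteq> E \<union> D'" "e \<in> X" for X
  proof -
    obtain C where C: "circ C" "e \<in> C" "C \<subseteq> X" using circ_through X by blast
    show ?thesis
    proof (cases "C \<inter> E = {}")
      case True
      then have "C \<subseteq> D'" using C X by auto
      then have "C = D'" using circD(3)[OF c] C circD by blast
      then show ?thesis using C by auto
    next
      case False
      then have "P C" using C X sub by (auto simp: P_def)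
      then have "card (D' - E) \<le> card (C - E)" by (rule min)
      moreover have "C - E \<subseteq> D' - E" using C X by auto
      moreover have "finite (D' - E)" using finite_cycle circD c by blast
      ultimately have "C - E = D' - E" using card_seteq by blast
      then show ?thesis using C by auto
    qed
  qed
  have "X \<subseteq> E \<or> sym_diff X D' \<subseteq> E" if X: "X \<in> \<C>" "X \<subseteq> E \<union> D'" for X
  proof (cases "e \<in> X")
    case True then show ?thesis using full[of X] X by auto
  next
    case False
    \<comment> \<open>Adding \<open>D'\<close> produces a cycle through \<open>e\<close>, which
      contains all of \<open>D' - E\<close> by \<open>full\<close>. Hence \<open>X\<close> avoids
      \<open>D' - E\<close>.\<close>
    then have "D' - E \<subseteq> sym_diff X D'" using X eD by (intro full sym_diff_cycle circD(1)[OF c]) auto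
    then show ?thesis using X by auto
  qed
  then show ?thesis using D' unfolding P_def by blast
qed

text \<open>The three circuits of a theta play symmetric roles: \<open>C\<close> and
  \<open>sym_diff C D\<close> generate the same four cycles as \<open>C\<close> and
  \<open>D\<close>. Neither \<open>C\<close> nor \<open>D\<close> fits into
  \<open>sym_diff C D\<close> because \<open>C\<close> and \<open>D\<close> intersect, which makes
  \<open>sym_diff C D\<close> a circuit.\<close>

lemma theta_sym_diff:
  assumes "theta C D" shows "theta C (sym_diff C D)"
proof -
  have c: "circ C" "circ D" "C \<noteq> D" "C \<inter> D \<noteq> {}"
    and cyc: "\<And>X. X \<in> \<C> \<Longrightarrow> X \<subseteq> C \<union> D \<Longrightarrow> X = {} \<or> X = C \<or> X = D \<or> X = sym_diff C D"
    using assms by (auto simp: theta_def)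
  have n: "\<not> C \<subseteq> D" "\<not> D \<subseteq> C" using c circD by blast+
  have "circ (sym_diff C D)"
    unfolding circ_def
  proof (intro conjI ballI impI)
    fix X assume X: "X \<in> \<C>" "X \<subseteq> sym_diff C D"
    then have "X = {} \<or> X = C \<or> X = D \<or> X = sym_diff C D" by (intro cyc) auto
    then show "X = {} \<or> X = sym_diff C D" using X c(4) by blast
  qed (use c n sym_diff_cycle circD in auto)
  moreover have "X = {} \<or> X = C \<or> X = sym_diff C D \<or> X = sym_diff C (sym_diff C D)"
    if "X \<in> \<C>" "X \<subseteq> C \<union> sym_diff C D" for X
  proof -
    have "sym_diff C (sym_diff C D) = D" by auto
    moreover have "X = {} \<or> X = C \<or> X = D \<or> X = sym_diff C D" using that by (intro cyc) auto
    ultimately show ?thesis by argo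
  qed
  ultimately show ?thesis using c n by (auto simp: theta_def)
qed

text \<open>An ear of the single circuit \<open>C\<close> suffices: a cycle in
  \<open>C \<union> D'\<close> is, possibly after adding \<open>D'\<close>, a cycle inside
  \<open>C\<close>, hence empty or \<open>C\<close>.\<close>

lemma theta_exists:
  assumes "circ C" "circ D" "e \<in> D" "e \<notin> C" "C \<inter> D \<noteq> {}"
  shows "\<exists>D'. theta C D' \<and> e \<in> D' \<and> D' \<subseteq> C \<union> D"
proof -
  obtain D' where D': "circ D'" "e \<in> D'" "D' \<inter> C \<noteq> {}" "D' \<subseteq> C \<union> D"
    and cyc: "\<forall>X\<in>\<C>. X \<subseteq> C \<union> D' \<longrightarrow> X \<subseteq> C \<or> sym_diff X D' \<subseteq> C"
    using ear_exists[OF assms(2-4)] assms(5) by (auto simp: Int_commute)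
  have "X = {} \<or> X = C \<or> X = D' \<or> X = sym_diff C D'" if X: "X \<in> \<C>" "X \<subseteq> C \<union> D'" for X
  proof (cases "X \<subseteq> C")
    case True then show ?thesis using circD(3) assms(1) X by blast
  next
    case False
    then have "sym_diff X D' \<subseteq> C" using cyc X by blast
    moreover have "sym_diff X D' \<in> \<C>" using X D' circD sym_diff_cycle by blast
    ultimately have "sym_diff X D' = {} \<or> sym_diff X D' = C" using circD(3) assms(1) by blast
    moreover have "X = sym_diff (sym_diff X D') D'" by auto
    ultimately show ?thesis by auto
  qed
  then have "theta C D'" using D' assms by (auto simp: theta_def)
  then show ?thesis using D' by blast
qed

section \<open>Connectedness by common circuits\<close>

lemma circ_trans:
  assumes "circ C" "circ D" "C \<inter> D \<noteq> {}" "x \<in> C" "z \<in> D"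
  shows "\<exists>K. circ K \<and> x \<in> K \<and> z \<in> K \<and> K \<subseteq> C \<union> D"
proof (cases "z \<in> C")
  case False
  then obtain D' where D': "theta C D'" "z \<in> D'" "D' \<subseteq> C \<union> D"
    using theta_exists assms by blast
  then have "circ D'" "circ (sym_diff C D')" using theta_sym_diff by (auto simp: theta_def)
  \<comment> \<open>The element \<open>z\<close> lies on both \<open>D'\<close> and
    \<open>sym_diff C D'\<close>, whereas \<open>x\<close>, being in \<open>C\<close>, lies on
    exactly one of them; that one is the circuit sought.\<close>
  moreover have "sym_diff C D' \<subseteq> C \<union> D" using D' by auto
  moreover have "x \<in> D' \<or> x \<in> sym_diff C D'" "z \<in> sym_diff C D'" using assms False D' by auto
  ultimately show ?thesis using D' by blast
qed (use assms in blast)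

lemma conn_Un:
  assumes "conn E" "circ D" "D \<inter> E \<noteq> {}"
  shows "conn (E \<union> D)"
proof -
  have *: "\<exists>K. circ K \<and> K \<subseteq> E \<union> D \<and> x \<in> K \<and> z \<in> K" if xz: "x \<in> E" "z \<in> D" for x z
  proof -
    obtain y where "y \<in> D \<inter> E" using assms by blast
    moreover from this obtain C where "circ C" "C \<subseteq> E" "x \<in> C" "y \<in> C"
      using assms xz unfolding conn_def by blast
    ultimately show ?thesis using circ_trans[of C D x z] xz assms(2) by blast
  qed
  show ?thesis
    unfolding conn_def
  proof (intro ballI)
    fix x y assume "x \<in> E \<union> D" "y \<in> E \<union> D"
    then consider "x \<in> E" "y \<in> E" | "x \<in> E" "y \<in> D" | "x \<in> D" "y \<in> E" | "x \<in> D" "y \<in> D" by blast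
    then show "\<exists>C. circ C \<and> C \<subseteq> E \<union> D \<and> x \<in> C \<and> y \<in> C"
    proof cases
      case 1 then show ?thesis using assms(1) unfolding conn_def by blast
    next
      case 2 then show ?thesis using * by blast
    next
      case 3 then show ?thesis using * by blast
    next
      case 4 then show ?thesis using assms(2) by blast
    qed
  qed
qed

text \<open>Connectedness gives a theta of \<open>C\<close> with a circuit \<open>D\<close> through
  \<open>e\<close>. As \<open>C\<close> is odd, exactly one of \<open>D\<close> and
  \<open>sym_diff C D\<close> is odd, and both contain \<open>e\<close>.\<close>

lemma odd_theta_exists:
  assumes "conn E" "circ C" "odd (card C)" "C \<subseteq> E" "e \<in> E" "e \<notin> C"
  shows "\<exists>D. theta C D \<and> odd (card D) \<and> e \<in> D \<and> D \<subseteq> E"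
proof -
  obtain x where x: "x \<in> C" using circD assms by blast
  then obtain K where K: "circ K" "K \<subseteq> E" "x \<in> K" "e \<in> K"
    using assms unfolding conn_def by blast
  then obtain D where D: "theta C D" "e \<in> D" "D \<subseteq> C \<union> K"
    using theta_exists[of C K e] assms x by blast
  have "finite C" "finite D" using D finite_cycle circD by (auto simp: theta_def)
  then have "odd (card D) \<or> odd (card (sym_diff C D))" using even_card_sym_diff assms(3) by blast
  moreover have "theta C (sym_diff C D)" "e \<in> sym_diff C D" using theta_sym_diff D assms by auto
  moreover have "D \<subseteq> E" "sym_diff C D \<subseteq> E" using D K assms by auto
  ultimately show ?thesis using D by blast
qed

section \<open>Passing from \<open>E\<close> to \<open>E\<close> with an ear\<close>

lemma cycle_Un_cases:
  assumes "\<forall>X\<in>\<C>. X \<subseteq> E \<union> D \<longrightarrow> X \<subseteq> E \<or> sym_diff X D \<subseteq> E" and "X \<in> \<C>" "Y \<in> \<C>"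
    "X \<subseteq> E \<union> D" "Y \<subseteq> E \<union> D" "\<not> X \<subseteq> E" "\<not> Y \<subseteq> E"
  shows "sym_diff X Y \<subseteq> E"
proof -
  \<comment> \<open>Outside \<open>E\<close>, both \<open>X\<close> and \<open>Y\<close> agree with
    \<open>D\<close>, hence with each other.\<close>
  have "sym_diff X D \<subseteq> E" "sym_diff Y D \<subseteq> E" using assms by blast+
  then show ?thesis by auto
qed

text \<open>By bilinearity: modulo cycles inside \<open>E\<close>, every cycle inside
  \<open>F\<close> is zero or \<open>D\<close>, so it suffices to compare both sides on pairs taken
  from the cycles of \<open>E\<close> and \<open>D\<close>.\<close>

lemma parity_form_extend:
  assumes "parity_form E" "D \<in> \<C>" "odd (card D)"
    and D: "\<And>X. X \<in> \<C> \<Longrightarrow> X \<subseteq> E \<Longrightarrow> odd (card (D \<inter> X)) \<longleftrightarrow> odd (card X)"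
    and F: "\<And>X. X \<in> \<C> \<Longrightarrow> X \<subseteq> F \<Longrightarrow> X \<subseteq> E \<or> sym_diff X D \<subseteq> E"
  shows "parity_form F"
proof -
  \<comment> \<open>For fixed \<open>X\<close> both sides are additive in \<open>Y\<close>, so the
    identity passes from the cycles of \<open>E\<close> and from \<open>D\<close> to all cycles of
    \<open>F\<close>.\<close>
  have step: "odd (card (X \<inter> Y)) \<longleftrightarrow> odd (card X) \<and> odd (card Y)"
    if X: "X \<in> \<C>" and Y: "Y \<in> \<C>" "Y \<subseteq> F"
      and E: "\<And>Y. Y \<in> \<C> \<Longrightarrow> Y \<subseteq> E \<Longrightarrow> odd (card (X \<inter> Y)) \<longleftrightarrow> odd (card X) \<and> odd (card Y)"
      and XD: "odd (card (X \<inter> D)) \<longleftrightarrow> odd (card X)" for X Y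
  proof (cases "Y \<subseteq> E")
    case False
    then have "sym_diff Y D \<subseteq> E" using F Y by blast
    then have "odd (card (X \<inter> sym_diff Y D)) \<longleftrightarrow> odd (card X) \<and> odd (card (sym_diff Y D))"
      using E sym_diff_cycle Y assms(2) by blast
    then show ?thesis
      using XD assms(3) even_card_Int_sym_diff[OF finite_cycle[OF X], of Y D]
        even_card_sym_diff[OF finite_cycle finite_cycle, OF Y(1) assms(2)] by blast
  qed (use E X Y in blast)
  \<comment> \<open>\<open>step\<close> is used for the second argument, and its two premises follow
    from \<open>step\<close> again with the roles exchanged: once for a cycle of \<open>E\<close>,
    once for \<open>D\<close>.\<close>
  have "odd (card (X \<inter> Y)) \<longleftrightarrow> odd (card X) \<and> odd (card Y)"
    if X: "X \<in> \<C>" "X \<subseteq> F" and Y: "Y \<in> \<C>" "Y \<subseteq> F" for X Y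
  proof (rule step[OF X(1) Y])
    fix Y assume Y: "Y \<in> \<C>" "Y \<subseteq> E"
    have "odd (card (Y \<inter> X)) \<longleftrightarrow> odd (card Y) \<and> odd (card X)"
    proof (rule step[OF Y(1) X])
      show "odd (card (Y \<inter> D)) \<longleftrightarrow> odd (card Y)" using D[OF Y] by (simp add: Int_commute)
    qed (use assms(1) Y in \<open>auto simp: parity_form_def\<close>)
    then show "odd (card (X \<inter> Y)) \<longleftrightarrow> odd (card X) \<and> odd (card Y)" by (auto simp: Int_commute)
  next
    have "odd (card (D \<inter> X)) \<longleftrightarrow> odd (card D) \<and> odd (card X)"
    proof (rule step[OF assms(2) X])
      show "odd (card (D \<inter> Y)) \<longleftrightarrow> odd (card D) \<and> odd (card Y)" if "Y \<in> \<C>" "Y \<subseteq> E" for Y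
        using D[OF that] assms(3) by simp
    qed simp
    then show "odd (card (X \<inter> D)) \<longleftrightarrow> odd (card X)" using assms(3) by (simp add: Int_commute)
  qed
  then show ?thesis unfolding parity_form_def by blast
qed

text \<open>
  Every odd circuit \<open>C\<close> in \<open>E\<close> forms a theta with some odd circuit through the new ear. Two odd
  circuits through the ear differ by an even cycle of \<open>E\<close>, to which \<open>C\<close> is orthogonal, so a
  single odd circuit through the ear meets all odd circuits of \<open>E\<close> in an odd number of elements.
\<close>

lemma ear_extend:
  assumes E: "conn E" "\<C> \<inter> Pow E \<subseteq> gen (odd_circs E)"
    and C0: "circ C0" "odd (card C0)" "C0 \<subseteq> E"
    and D: "circ D" "e \<in> D" "e \<notin> E" "D \<inter> E \<noteq> {}"
    and ear: "\<forall>X\<in>\<C>. X \<subseteq> E \<union> D \<longrightarrow> X \<subseteq> E \<or> sym_diff X D \<subseteq> E"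
  shows "\<C> \<inter> Pow (E \<union> D) \<subseteq> gen (odd_circs (E \<union> D))"
    and "\<lbrakk>\<And>C D. theta C D \<Longrightarrow> odd (card C) \<Longrightarrow> odd (card D) \<Longrightarrow> odd (card (C \<inter> D)); parity_form E\<rbrakk>
      \<Longrightarrow> parity_form (E \<union> D)"
proof -
  have con: "conn (E \<union> D)" using conn_Un E D by blast
  \<comment> \<open>The ear \<open>D\<close> itself may be even; the odd circuit \<open>K\<close>
    replaces it as the representative of the cycles that leave \<open>E\<close>.\<close>
  obtain K where K: "theta C0 K" "odd (card K)" "e \<in> K" "K \<subseteq> E \<union> D"
    using odd_theta_exists[OF con C0(1,2)] C0 D by blast
  have cK: "circ K" using K by (simp add: theta_def)
  have X: "X \<subseteq> E \<or> sym_diff X K \<subseteq> E" if "X \<in> \<C>" "X \<subseteq> E \<union> D" for X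
    using cycle_Un_cases[OF ear that(1) circD(1)[OF cK]] that K D by blast
  have sub: "odd_circs E \<subseteq> odd_circs (E \<union> D)" by (auto simp: odd_circs_def)
  have KO: "K \<in> odd_circs (E \<union> D)" using K cK by (simp add: odd_circs_def)
  show "\<C> \<inter> Pow (E \<union> D) \<subseteq> gen (odd_circs (E \<union> D))"
  proof
    fix Y assume Y: "Y \<in> \<C> \<inter> Pow (E \<union> D)"
    show "Y \<in> gen (odd_circs (E \<union> D))"
    proof (cases "Y \<subseteq> E")
      case True then show ?thesis using Y E(2) gen_mono[OF _ sub] by blast
    next
      case False
      then have "sym_diff Y K \<subseteq> E" using X Y by blast
      moreover have "sym_diff Y K \<in> \<C>" using Y sym_diff_cycle circD(1)[OF cK] by blast
      ultimately have "sym_diff Y K \<in> gen (odd_circs (E \<union> D))"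
        by (intro gen_mono[OF _ sub] subsetD[OF E(2)] IntI PowI)
      then have "sym_diff (sym_diff Y K) K \<in> gen (odd_circs (E \<union> D))"
        using KO by (rule gen.step)
      moreover have "sym_diff (sym_diff Y K) K = Y" by auto
      ultimately show ?thesis by simp
    qed
  qed
  assume free: "\<And>C D. theta C D \<Longrightarrow> odd (card C) \<Longrightarrow> odd (card D) \<Longrightarrow> odd (card (C \<inter> D))"
    and pf: "parity_form E"
  have circ_K: "odd (card (K \<inter> C))" if C: "C \<in> odd_circs E" for C
  proof -
    have C': "circ C" "odd (card C)" "C \<subseteq> E" using C by (auto simp: odd_circs_def)
    then obtain K' where K': "theta C K'" "odd (card K')" "e \<in> K'" "K' \<subseteq> E \<union> D"
      using odd_theta_exists[OF con C'(1,2)] D by blast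
    then have cK': "circ K'" by (simp add: theta_def)
    have "odd (card (C \<inter> K'))" using free K' C' by blast
    moreover have "sym_diff K' K \<subseteq> E"
      using X[OF circD(1)[OF cK'] K'(4)] K' D(3) by blast
    moreover have "even (card (sym_diff K' K))"
      using even_card_sym_diff[OF finite_cycle finite_cycle, OF circD(1) circD(1), OF cK' cK] K K' by blast
    moreover have "sym_diff K' K \<in> \<C>" using sym_diff_cycle circD(1) cK cK' by blast
    ultimately have "even (card (C \<inter> sym_diff K' K))"
      using pf circD(1)[OF C'(1)] C'(3) unfolding parity_form_def by blast
    then show ?thesis
      using even_card_Int_sym_diff[OF finite_cycle[OF circD(1)[OF C'(1)]], of K' K]
        \<open>odd (card (C \<inter> K'))\<close> by (simp add: Int_commute)
  qed
  \<comment> \<open>Both parities are additive in \<open>Y\<close>, so agreement on the odd circuits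
    of \<open>E\<close>, which generate, gives agreement on all cycles of \<open>E\<close>.\<close>
  have "finite Y \<and> (odd (card (K \<inter> Y)) \<longleftrightarrow> odd (card Y))" if "Y \<in> gen (odd_circs E)" for Y
    using that
  proof induction
    case (step Y C)
    moreover have "finite C" "odd (card C)"
      using step finite_cycle circD(1) by (auto simp: odd_circs_def)
    ultimately show ?case
      using circ_K[of C] even_card_Int_sym_diff[OF finite_cycle[OF circD(1)[OF cK]], of Y C]
        even_card_sym_diff[of Y C] by blast
  qed simp
  then have *: "odd (card (K \<inter> Y)) \<longleftrightarrow> odd (card Y)" if "Y \<in> \<C>" "Y \<subseteq> E" for Y
    using that E(2) by blast
  show "parity_form (E \<union> D)"
    by (rule parity_form_extend[OF pf circD(1)[OF cK] K(2) *]) (use X in blast)+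
qed

text \<open>Both invariants run through one induction on the number of elements outside
  \<open>E\<close>, because carrying (P) over an ear needs odd circuits to generate the cycles of
  \<open>E\<close>. The hypothesis on thetas is confined to the second invariant, since generation
  has to be available without it.\<close>

lemma ear_induction:
  assumes "conn S" and C0: "circ C0" "odd (card C0)" "C0 \<subseteq> E" and "E \<subseteq> S" "conn E"
    and "\<C> \<inter> Pow E \<subseteq> gen (odd_circs E)"
    and "(\<forall>C D. theta C D \<longrightarrow> odd (card C) \<longrightarrow> odd (card D) \<longrightarrow> odd (card (C \<inter> D))) \<longrightarrow> parity_form E"
  shows "\<C> \<subseteq> gen (odd_circs S) \<and>
    ((\<forall>C D. theta C D \<longrightarrow> odd (card C) \<longrightarrow> odd (card D) \<longrightarrow> odd (card (C \<inter> D))) \<longrightarrow> parity_form S)"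
  using assms(4-8)
proof (induction "card (S - E)" arbitrary: E rule: less_induct)
  case less
  show ?case
  proof (cases "E = S")
    case True then show ?thesis using less.prems cycle_subset by blast
  next
    case False
    then obtain e where e: "e \<in> S" "e \<notin> E" using less.prems by blast
    obtain x where x: "x \<in> E" using less.prems circD(2) C0 by blast
    then obtain D0 where "circ D0" "x \<in> D0" "e \<in> D0"
      using \<open>conn S\<close> e less.prems unfolding conn_def by blast
    then obtain D where D: "circ D" "e \<in> D" "D \<inter> E \<noteq> {}"
      and ear: "\<forall>X\<in>\<C>. X \<subseteq> E \<union> D \<longrightarrow> X \<subseteq> E \<or> sym_diff X D \<subseteq> E"
      using ear_exists[of D0 e E] e x by blast
    have DS: "D \<subseteq> S" using D circD(1) cycle_subset by blast
    have lt: "card (S - (E \<union> D)) < card (S - E)"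
      using e D finite_S by (intro psubset_card_mono) auto
    note g = ear_extend[OF less.prems(3,4) C0(1,2) less.prems(1) D(1,2) e(2) D(3) ear]
    have "C0 \<subseteq> E \<union> D" "E \<union> D \<subseteq> S" using less.prems DS by auto
    note hyp = less.hyps[OF lt this conn_Un[OF less.prems(3) D(1,3)] g(1)]
    show ?thesis
    proof (rule hyp, intro impI)
      assume free: "\<forall>C D. theta C D \<longrightarrow> odd (card C) \<longrightarrow> odd (card D) \<longrightarrow> odd (card (C \<inter> D))"
      show "parity_form (E \<union> D)"
        by (rule g(2)) (use free less.prems(5) in simp_all)
    qed
  qed
qed

text \<open>The ear construction starts at \<open>C0\<close>, whose only subcycles are the empty set
  and \<open>C0\<close>, so that both invariants hold there.\<close>

lemma odd_circs_generate:
  assumes "conn S" "circ C0" "odd (card C0)"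
  shows "\<C> \<subseteq> gen (odd_circs S)"
    and "(\<And>C D. theta C D \<Longrightarrow> odd (card C) \<Longrightarrow> odd (card D) \<Longrightarrow> odd (card (C \<inter> D))) \<Longrightarrow> parity_form S"
proof -
  have "\<C> \<inter> Pow C0 \<subseteq> {{}, C0}" using circD(3) assms(2) by blast
  moreover have "C0 \<in> gen (odd_circs C0)" using assms by (intro gen_base) (simp add: odd_circs_def)
  ultimately have g: "\<C> \<inter> Pow C0 \<subseteq> gen (odd_circs C0)" using gen.empty by blast
  have "parity_form C0"
    unfolding parity_form_def
  proof (intro ballI impI)
    fix X Y assume "X \<in> \<C>" "Y \<in> \<C>" "X \<subseteq> C0" "Y \<subseteq> C0"
    then have "(X = {} \<or> X = C0) \<and> (Y = {} \<or> Y = C0)" using circD(3)[OF assms(2)] by blast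
    then show "odd (card (X \<inter> Y)) \<longleftrightarrow> odd (card X) \<and> odd (card Y)" using assms(3) by auto
  qed
  moreover have "conn C0" using assms(2) by (auto simp: conn_def)
  moreover have "C0 \<subseteq> S" using assms circD(1) cycle_subset by blast
  ultimately have "\<C> \<subseteq> gen (odd_circs S) \<and>
    ((\<forall>C D. theta C D \<longrightarrow> odd (card C) \<longrightarrow> odd (card D) \<longrightarrow> odd (card (C \<inter> D))) \<longrightarrow> parity_form S)"
    using ear_induction[OF assms(1-3), of C0] g by blast
  then show "\<C> \<subseteq> gen (odd_circs S)"
    and "(\<And>C D. theta C D \<Longrightarrow> odd (card C) \<Longrightarrow> odd (card D) \<Longrightarrow> odd (card (C \<inter> D))) \<Longrightarrow> parity_form S"
    by blast+
qed

end

section \<open>Cycles of binary matroids\<close>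

lemma bit_fun_add_self: "v + v = (0 :: 'b \<Rightarrow> bit)"
  by (auto simp: fun_eq_iff)

lemma sum_sym_diff:
  fixes \<phi> :: "'a \<Rightarrow> 'b \<Rightarrow> bit"
  assumes "finite X" "finite Y"
  shows "sum \<phi> (sym_diff X Y) = sum \<phi> X + sum \<phi> Y"
proof -
  have "sum \<phi> (sym_diff X Y) = sum \<phi> (X - Y) + sum \<phi> (Y - X)"
    using assms by (intro sum.union_disjoint) auto
  moreover have "sum \<phi> X = sum \<phi> (X \<inter> Y) + sum \<phi> (X - Y)" "sum \<phi> Y = sum \<phi> (X \<inter> Y) + sum \<phi> (Y - X)"
    using assms sum.Int_Diff[of X \<phi> Y] sum.Int_Diff[of Y \<phi> X] by (simp_all add: Int_commute)
  moreover have "(a + b) + (a + c) = (a + a) + (b + c)" for a b c :: "'b \<Rightarrow> bit"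
    by (simp add: ac_simps)
  ultimately show ?thesis by (simp add: bit_fun_add_self)
qed

text \<open>With coefficients 0 and 1, linear combinations of the family are subset sums. Two equal
  members already have sum zero, which accounts for injectivity.\<close>

lemma independent_family_iff:
  fixes \<phi> :: "'a \<Rightarrow> 'b \<Rightarrow> bit"
  assumes "finite X"
  shows "inj_on \<phi> X \<and> F2.independent (\<phi> ` X) \<longleftrightarrow> (\<forall>Z\<subseteq>X. sum \<phi> Z = 0 \<longrightarrow> Z = {})"
proof (intro iffI conjI allI impI)
  fix Z assume *: "inj_on \<phi> X \<and> F2.independent (\<phi> ` X)" and Z: "Z \<subseteq> X" "sum \<phi> Z = 0"
  have inj: "inj_on \<phi> Z" using * Z inj_on_subset by blast
  have "finite Z" using Z assms finite_subset by blast
  have "(\<Sum>v\<in>\<phi> ` Z. (\<lambda>i. 1 * v i)) = 0" using Z(2) sum.reindex[OF inj, of id] by (simp only: mult_1_left) simp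
  then have "(1::bit) = 0" if "x \<in> Z" for x
    using F2.independentD[of "\<phi> ` X" "\<phi> ` Z" "\<lambda>_. 1" "\<phi> x"] * Z \<open>finite Z\<close> that by blast
  then show "Z = {}" by auto
next
  assume *: "\<forall>Z\<subseteq>X. sum \<phi> Z = 0 \<longrightarrow> Z = {}"
  show inj: "inj_on \<phi> X"
  proof (rule inj_onI, rule ccontr)
    fix x y assume xy: "x \<in> X" "y \<in> X" "\<phi> x = \<phi> y" "x \<noteq> y"
    then have "sum \<phi> {x, y} = 0" by (simp add: bit_fun_add_self)
    moreover have "{x, y} \<subseteq> X" using xy by simp
    ultimately show False using * by (metis insert_not_empty)
  qed
  show "F2.independent (\<phi> ` X)"
    unfolding F2.independent_explicit_module
  proof (intro allI impI, rule ccontr)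
    fix t u v
    assume t: "finite t" "t \<subseteq> \<phi> ` X" "(\<Sum>v\<in>t. (\<lambda>i. u v * v i)) = 0" "v \<in> t" "u v \<noteq> (0::bit)"
    \<comment> \<open>The nonzero coefficients, pulled back along \<open>\<phi>\<close>, so that the
      vanishing combination becomes the sum over \<open>Z\<close>.\<close>
    define Z where "Z = {x \<in> X. \<phi> x \<in> t \<and> u (\<phi> x) \<noteq> 0}"
    have im: "\<phi> ` Z = {v \<in> t. u v \<noteq> 0}" using t(2) by (auto simp: Z_def)
    have "sum \<phi> Z = (\<Sum>v\<in>\<phi> ` Z. v)"
      using sum.reindex[of \<phi> Z id] inj by (simp add: Z_def inj_on_def)
    also have "\<dots> = (\<Sum>v\<in>\<phi> ` Z. (\<lambda>i. u v * v i))"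
      unfolding im by (intro sum.cong) auto
    also have "\<dots> = (\<Sum>v\<in>t. (\<lambda>i. u v * v i))"
      unfolding im using t(1) by (intro sum.mono_neutral_left) (auto simp: fun_eq_iff)
    finally have "sum \<phi> Z = 0" using t(3) by simp
    moreover have "Z \<subseteq> X" by (simp add: Z_def)
    ultimately have "Z = {}" using * by simp
    moreover have "v \<in> \<phi> ` Z" using im t(4,5) by simp
    ultimately show False by simp
  qed
qed

text \<open>In terms of supports, this family is the kernel of the matrix with columns
  \<open>\<phi> x\<close>.\<close>

lemma zero_sum_cycle_family:
  fixes \<phi> :: "'a \<Rightarrow> 'b \<Rightarrow> bit"
  assumes "finite S"
  shows "cycle_family S {Z. Z \<subseteq> S \<and> sum \<phi> Z = 0}"
proof
  fix X Y assume "X \<in> {Z. Z \<subseteq> S \<and> sum \<phi> Z = 0}" "Y \<in> {Z. Z \<subseteq> S \<and> sum \<phi> Z = 0}"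
  then show "sym_diff X Y \<in> {Z. Z \<subseteq> S \<and> sum \<phi> Z = 0}"
    using sum_sym_diff[of X Y \<phi>] assms finite_subset[of _ S] by auto
qed (use assms in auto)

section \<open>Incidence vectors and parity on spans\<close>

lemma indicator_sym_diff:
  "(indicator (sym_diff X Y) :: 'a \<Rightarrow> bit) = indicator X + indicator Y"
  by (auto simp: fun_eq_iff indicator_def)

lemma indicator_bit_inject: "(indicator X :: 'a \<Rightarrow> bit) = indicator Y \<longleftrightarrow> X = Y"
  by (auto simp: fun_eq_iff indicator_def split: if_splits)

lemma span_indicator: "F2.span ((indicator :: 'a set \<Rightarrow> 'a \<Rightarrow> bit) ` B) = indicator ` gen B"
proof (intro subset_antisym subsetI)
  fix v assume "v \<in> F2.span ((indicator :: 'a set \<Rightarrow> 'a \<Rightarrow> bit) ` B)"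
  then show "v \<in> indicator ` gen B"
  proof (induction rule: F2.span_induct_alt)
    case base
    have "(0 :: 'a \<Rightarrow> bit) = indicator {}" by (auto simp: fun_eq_iff)
    then show ?case using gen.empty by blast
  next
    case (step c x y)
    then obtain X Y where XY: "X \<in> B" "x = indicator X" "Y \<in> gen B" "y = indicator Y" by blast
    show ?case
    proof (cases c)
      case zero
      then have "(\<lambda>i. c * x i) + y = indicator Y" using XY by (auto simp: fun_eq_iff)
      then show ?thesis using XY by blast
    next
      case one
      then have "(\<lambda>i. c * x i) + y = indicator (sym_diff Y X)"
        using XY by (auto simp: fun_eq_iff indicator_sym_diff add.commute)
      then show ?thesis using XY gen.step by blast
    qed
  qed
next
  fix v :: "'a \<Rightarrow> bit" assume "v \<in> indicator ` gen B"
  then obtain X where "X \<in> gen B" "v = indicator X" by blast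
  moreover have "(indicator X :: 'a \<Rightarrow> bit) \<in> F2.span (indicator ` B)" if "X \<in> gen B" for X
    using that
  proof induction
    case empty
    have "(indicator {} :: 'a \<Rightarrow> bit) = 0" by (auto simp: fun_eq_iff)
    then show ?case using F2.span_zero by metis
  next
    case (step X Y)
    then show ?case using F2.span_add F2.span_base unfolding indicator_sym_diff by blast
  qed
  ultimately show "v \<in> F2.span (indicator ` B)" by blast
qed

text \<open>Both sides are additive in each argument, so it suffices to compare them on
  \<open>B\<close>, where both hold: for distinct members by the last hypothesis, for equal ones
  because members are odd.\<close>

lemma gen_parity:
  assumes "\<And>X. X \<in> B \<Longrightarrow> finite X" "\<And>X. X \<in> B \<Longrightarrow> odd (card X)"
    and "\<And>X Y. X \<in> B \<Longrightarrow> Y \<in> B \<Longrightarrow> X \<noteq> Y \<Longrightarrow> odd (card (X \<inter> Y))"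
    and X: "X \<in> gen B" and Y: "Y \<in> gen B"
  shows "odd (card (X \<inter> Y)) \<longleftrightarrow> odd (card X) \<and> odd (card Y)"
proof -
  have fin: "finite X" if "X \<in> gen B" for X
    using that by induction (auto simp: assms(1))
  have base: "odd (card (X \<inter> Y)) \<longleftrightarrow> odd (card Y)" if "X \<in> B" "Y \<in> gen B" for X Y
    using that(2)
  proof induction
    case (step Y Z)
    have "odd (card (X \<inter> Z))" using assms(2,3) that(1) step by (cases "X = Z") auto
    then show ?case
      using step even_card_sym_diff[OF fin assms(1), of Y Z] assms(2)
        even_card_Int_sym_diff[OF assms(1), of X Y Z] that(1) by blast
  qed simp
  show ?thesis using X
  proof induction
    case (step X Z)
    then show ?case
      using even_card_sym_diff[OF fin assms(1), of X Z] assms(2) base[OF step(2) Y]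
        even_card_Int_sym_diff[OF fin, of Y X Z] Y by (auto simp: Int_commute)
  qed simp
qed

text \<open>The link between matroid and cycle space: the dependent sets are those that contain a
  nonempty member of the family.\<close>

locale binary_cycles = cycle_family "ground M" \<C> for M :: "'a matroid" and \<C> +
  assumes indep_iff: "X \<subseteq> ground M \<Longrightarrow> indep M X \<longleftrightarrow> (\<forall>Z\<in>\<C>. Z \<subseteq> X \<longrightarrow> Z = {})"
begin

section \<open>Circuits, cycles and cycle bases of the matroid\<close>

lemma circuit_iff: "circuit M C \<longleftrightarrow> circ C"
proof
  assume C: "circuit M C"
  then have sub: "C \<subseteq> ground M" by (simp add: circuit_def)
  have *: "D = {} \<or> D = C" if "D \<in> \<C>" "D \<subseteq> C" for D
  proof (rule ccontr)
    assume "\<not> (D = {} \<or> D = C)"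
    then have "indep M D" using C that by (auto simp: circuit_def)
    then show False using indep_iff[of D] that sub \<open>\<not> (D = {} \<or> D = C)\<close> by blast
  qed
  have "\<not> indep M C" using C by (simp add: circuit_def)
  then obtain Z where "Z \<in> \<C>" "Z \<subseteq> C" "Z \<noteq> {}" using indep_iff[OF sub] by blast
  then show "circ C" using * unfolding circ_def by blast
next
  assume C: "circ C"
  then have sub: "C \<subseteq> ground M" using circD(1) cycle_subset by blast
  show "circuit M C"
    unfolding circuit_def
  proof (intro conjI allI impI)
    show "\<not> indep M C" using indep_iff[OF sub] circD[OF C] by blast
    fix D assume D: "D \<subset> C"
    then have "D \<subseteq> ground M" using sub by blast
    then show "indep M D" using indep_iff[of D] D circD(3)[OF C] by blast
  qed (rule sub)
qed

text \<open>A disjoint union of circuits is their symmetric difference. Conversely, removing a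
  circuit from a nonempty cycle leaves a smaller cycle, which is decomposed inductively.\<close>

lemma matroid_cycle_iff: "matroid_cycle M Z \<longleftrightarrow> Z \<in> \<C>"
proof
  assume "matroid_cycle M Z"
  then obtain \<D> where \<D>: "\<forall>C\<in>\<D>. circ C" "disjoint \<D>" "Z = \<Union>\<D>"
    by (auto simp: matroid_cycle_def circuit_iff)
  have "\<D> \<subseteq> Pow (ground M)" using \<D>(1) circD(1) cycle_subset by blast
  then have "finite \<D>" using finite_S finite_subset by blast
  then have "\<Union>\<D> \<in> \<C>" using \<D>(1,2)
  proof (induction \<D> rule: finite_induct)
    case empty then show ?case using empty_cycle by simp
  next
    case (insert C \<D>)
    then have "\<Union>\<D> \<in> \<C>" by (simp add: disjoint_def)
    moreover have "C \<inter> \<Union>\<D> = {}"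
      using insert.hyps(2) insert.prems(2) by (auto simp: disjoint_def)
    then have "\<Union>(insert C \<D>) = sym_diff C (\<Union>\<D>)" by auto
    ultimately show ?case using insert.prems circD(1) sym_diff_cycle by simp
  qed
  then show "Z \<in> \<C>" using \<D> by simp
next
  assume "Z \<in> \<C>"
  with finite_cycle[OF this] show "matroid_cycle M Z"
  proof (induction Z rule: finite_psubset_induct)
    case (psubset Z)
    show ?case
    proof (cases "Z = {}")
      case True then show ?thesis unfolding matroid_cycle_def by (intro exI[of _ "{}"]) auto
    next
      case False
      then obtain C where C: "circ C" "C \<subseteq> Z" using circ_through[OF psubset.prems] by blast
      have "sym_diff Z C = Z - C" using C by auto
      then have "Z - C \<in> \<C>" using sym_diff_cycle[OF psubset.prems circD(1)[OF C(1)]] by simp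
      moreover have "Z - C \<subset> Z" using C circD(2) by blast
      ultimately have "matroid_cycle M (Z - C)" by (intro psubset.IH)
      then obtain \<D> where \<D>: "\<forall>C\<in>\<D>. circuit M C" "disjoint \<D>" "Z - C = \<Union>\<D>"
        unfolding matroid_cycle_def by blast
      have "disjoint (insert C \<D>)" using \<D>(2,3) by (auto simp: disjoint_def)
      moreover have "Z = \<Union>(insert C \<D>)" using \<D>(3) C by auto
      ultimately show ?thesis
        unfolding matroid_cycle_def using \<D>(1) C(1) circuit_iff by (intro exI[of _ "insert C \<D>"]) auto
    qed
  qed
qed

lemma cycle_basis_iff:
  "cycle_basis M B \<longleftrightarrow>
     B \<subseteq> \<C> \<and> F2.independent ((indicator :: 'a set \<Rightarrow> 'a \<Rightarrow> bit) ` B) \<and> gen B = \<C>"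
proof -
  have "indicator ` gen B = cycle_space M \<longleftrightarrow> gen B = \<C>"
    unfolding cycle_space_def matroid_cycle_iff Collect_mem_eq
    by (intro inj_image_eq_iff injI) (simp add: indicator_bit_inject)
  then show ?thesis unfolding cycle_basis_def span_indicator matroid_cycle_iff by blast
qed

lemma gen_subset_cycles: "B \<subseteq> \<C> \<Longrightarrow> gen B \<subseteq> \<C>"
proof
  fix X assume B: "B \<subseteq> \<C>" and "X \<in> gen B"
  from this(2) show "X \<in> \<C>" by induction (use B empty_cycle sym_diff_cycle in blast)+
qed

text \<open>A maximal independent set of incidence vectors is selected from the generating odd
  circuits.\<close>

lemma odd_circuit_basis_exists:
  assumes "\<C> \<subseteq> gen (odd_circs (ground M))"
  shows "\<exists>B. circuit_basis M B \<and> odd_cycle_basis M B"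
proof -
  define I where "I = (indicator :: 'a set \<Rightarrow> 'a \<Rightarrow> bit)"
  obtain B' where B': "B' \<subseteq> I ` odd_circs (ground M)" "F2.independent B'"
    "I ` odd_circs (ground M) \<subseteq> F2.span B'"
    using F2.maximal_independent_subset by blast
  then obtain B where B: "B \<subseteq> odd_circs (ground M)" "B' = I ` B"
    by (auto simp: subset_image_iff)
  have BC: "B \<subseteq> \<C>" using B circD(1) by (auto simp: odd_circs_def)
  have "F2.span (I ` odd_circs (ground M)) \<subseteq> F2.span (I ` B)"
    by (rule F2.span_minimal) (use B'(3) B(2) F2.subspace_span in simp_all)
  then have "gen (odd_circs (ground M)) \<subseteq> gen B"
    unfolding I_def span_indicator by (auto simp: image_subset_iff indicator_bit_inject)
  then have "gen B = \<C>" using assms gen_subset_cycles[OF BC] by blast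
  then have "cycle_basis M B" using BC B' B unfolding cycle_basis_iff I_def by blast
  then show ?thesis
    using B unfolding circuit_basis_def odd_cycle_basis_def circuit_iff odd_circs_def by blast
qed

text \<open>The right-hand side does not mention \<open>B\<close>: all odd cycle bases are totally
  odd or none is.\<close>

lemma totally_odd_iff_parity_form:
  assumes "odd_cycle_basis M B"
  shows "totally_odd_cycle_basis M B \<longleftrightarrow> parity_form (ground M)"
proof
  have B: "B \<subseteq> \<C>" "gen B = \<C>" "\<And>Z. Z \<in> B \<Longrightarrow> odd (card Z)"
    using assms by (auto simp: odd_cycle_basis_def cycle_basis_iff)
  { assume "totally_odd_cycle_basis M B"
    then have "odd (card (X \<inter> Y)) \<longleftrightarrow> odd (card X) \<and> odd (card Y)" if "X \<in> \<C>" "Y \<in> \<C>" for X Y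
      using that B finite_cycle gen_parity[of B X Y] unfolding totally_odd_cycle_basis_def by blast
    then show "parity_form (ground M)" unfolding parity_form_def by blast
  }
  assume "parity_form (ground M)"
  then have "odd (card (X \<inter> Y))" if "X \<in> B" "Y \<in> B" for X Y
    using that B cycle_subset unfolding parity_form_def by blast
  then show "totally_odd_cycle_basis M B" using assms unfolding totally_odd_cycle_basis_def by blast
qed

lemma conn_ground:
  assumes "matroid_connected M" shows "conn (ground M)"
  unfolding conn_def
proof (intro ballI)
  fix x y assume xy: "x \<in> ground M" "y \<in> ground M"
  have two: "\<exists>C. circ C \<and> C \<subseteq> ground M \<and> x \<in> C \<and> z \<in> C" if "z \<in> ground M" "x \<noteq> z" for z
    using assms that xy cycle_subset circD(1) unfolding matroid_connected_def circuit_iff by blast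
  \<comment> \<open>This serves the case \<open>x = y\<close>: a circuit through \<open>x\<close> is
    obtained from a second element of the ground set.\<close>
  have "\<exists>z\<in>ground M. x \<noteq> z"
  proof (rule ccontr)
    assume "\<not> (\<exists>z\<in>ground M. x \<noteq> z)"
    then have "card (ground M) \<le> card {x}" by (intro card_mono) auto
    then show False using assms by (simp add: matroid_connected_def)
  qed
  then show "\<exists>C. circ C \<and> C \<subseteq> ground M \<and> x \<in> C \<and> y \<in> C" using two xy by (cases "x = y") blast+
qed

end

text \<open>The family is the kernel of a representing matrix; \<open>independent_family_iff\<close>
  turns linear independence into the absence of nonempty members.\<close>

lemma binary_cycles_exists:
  assumes "is_matroid M" "binary M"
  shows "\<exists>\<C>. binary_cycles M \<C>"
proof -
  obtain \<phi> :: "'a \<Rightarrow> nat \<Rightarrow> bit" where \<phi>: "\<And>X. X \<subseteq> ground M \<Longrightarrow>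
      indep M X \<longleftrightarrow> inj_on \<phi> X \<and> F2.independent (\<phi> ` X)"
    using assms(2) unfolding binary_def by blast
  have fin: "finite (ground M)" using assms(1) by (simp add: is_matroid_def)
  define \<C> where "\<C> = {Z. Z \<subseteq> ground M \<and> sum \<phi> Z = 0}"
  have "binary_cycles M \<C>"
    unfolding binary_cycles_def binary_cycles_axioms_def
  proof (intro conjI allI impI)
    show "cycle_family (ground M) \<C>" unfolding \<C>_def by (rule zero_sum_cycle_family[OF fin])
    fix X assume X: "X \<subseteq> ground M"
    then have "indep M X \<longleftrightarrow> (\<forall>Z\<subseteq>X. sum \<phi> Z = 0 \<longrightarrow> Z = {})"
      using \<phi>[OF X] independent_family_iff[of X \<phi>] fin finite_subset by blast
    then show "indep M X \<longleftrightarrow> (\<forall>Z\<in>\<C>. Z \<subseteq> X \<longrightarrow> Z = {})" using X unfolding \<C>_def by blast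
  qed
  then show ?thesis by blast
qed

section \<open>Cycles of theta graphs\<close>

lemma inner_verts_conv_nth:
  assumes "length vs = Suc n"
  shows "inner_verts vs = {vs ! i | i. 0 < i \<and> i < n}"
proof -
  have len: "length (butlast (tl vs)) = n - 1" using assms by simp
  have nth: "butlast (tl vs) ! i = vs ! Suc i" if "i < n - 1" for i
    using that assms by (simp add: nth_butlast nth_tl)
  show ?thesis
    unfolding inner_verts_def set_conv_nth len
  proof (intro set_eqI iffI; clarify)
    fix i assume "i < n - 1"
    then show "\<exists>j. butlast (tl vs) ! i = vs ! j \<and> 0 < j \<and> j < n"
      using nth by (intro exI[of _ "Suc i"]) auto
  next
    fix i assume i: "0 < i" "i < n"
    then have "vs ! i = butlast (tl vs) ! (i - 1)" using nth[of "i - 1"] by simp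
    then show "\<exists>j. vs ! i = butlast (tl vs) ! j \<and> j < n - 1"
      using i by (intro exI[of _ "i - 1"]) auto
  qed
qed

lemma inner_verts_rev: "inner_verts (rev vs) = inner_verts vs"
  by (cases vs rule: rev_cases) (auto simp: inner_verts_def butlast_rev butlast_tl)

text \<open>An oriented path of positive length, given by its first and last vertex through indices,
  which suits reversal and concatenation.\<close>

definition joins :: "('v, 'e) graph \<Rightarrow> 'v \<Rightarrow> 'v \<Rightarrow> 'v list \<Rightarrow> 'e list \<Rightarrow> bool" where
  "joins G u w vs es \<longleftrightarrow> is_path G vs es \<and> es \<noteq> [] \<and> vs ! 0 = u \<and> vs ! length es = w"

lemma joinsD:
  assumes "joins G u w vs es"
  shows "length vs = Suc (length es)" "distinct vs" "set vs \<subseteq> verts G" "set es \<subseteq> edges G"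
    "\<And>i. i < length es \<Longrightarrow> ends G (es ! i) = {vs ! i, vs ! Suc i}"
    "0 < length es" "vs ! 0 = u" "vs ! length es = w" "u \<noteq> w"
    "set vs = {u, w} \<union> inner_verts vs" "u \<notin> inner_verts vs" "w \<notin> inner_verts vs"
proof -
  show l: "length vs = Suc (length es)" and d: "distinct vs" "set vs \<subseteq> verts G" "set es \<subseteq> edges G"
    "\<And>i. i < length es \<Longrightarrow> ends G (es ! i) = {vs ! i, vs ! Suc i}"
    and e: "0 < length es" "vs ! 0 = u" "vs ! length es = w"
    using assms by (auto simp: joins_def is_path_def)
  have eq: "vs ! i = vs ! j \<longleftrightarrow> i = j" if "i \<le> length es" "j \<le> length es" for i j
    using nth_eq_iff_index_eq[OF d(1)] l that by simp
  note inn = inner_verts_conv_nth[OF l]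
  show "u \<noteq> w" using eq[of 0 "length es"] e by auto
  show "u \<notin> inner_verts vs" "w \<notin> inner_verts vs"
    unfolding inn e(2,3)[symmetric] using eq by (auto simp: less_imp_le)
  show "set vs = {u, w} \<union> inner_verts vs"
  proof
    show "set vs \<subseteq> {u, w} \<union> inner_verts vs"
    proof
      fix x assume "x \<in> set vs"
      then obtain i where "i \<le> length es" "x = vs ! i" using l by (auto simp: in_set_conv_nth less_Suc_eq_le)
      then show "x \<in> {u, w} \<union> inner_verts vs" unfolding inn using e
        by (cases "i = 0"; cases "i = length es") auto
    qed
    show "{u, w} \<union> inner_verts vs \<subseteq> set vs"
      unfolding inn e(2,3)[symmetric] using l by auto
  qed
qed

lemma joins_nth_eq_iff:
  assumes "joins G u w vs es" "i \<le> length es" "j \<le> length es"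
  shows "vs ! i = vs ! j \<longleftrightarrow> i = j"
  using nth_eq_iff_index_eq[OF joinsD(2)[OF assms(1)]] joinsD(1)[OF assms(1)] assms(2,3) by simp

lemma joins_distinct_edges:
  assumes "joins G u w vs es" shows "distinct es"
  unfolding distinct_conv_nth
proof (intro allI impI notI)
  fix i j assume ij: "i < length es" "j < length es" "i \<noteq> j" "es ! i = es ! j"
  then have "{vs ! i, vs ! Suc i} = {vs ! j, vs ! Suc j}" using joinsD(5)[OF assms] by metis
  \<comment> \<open>Equal edges are traversed either in the same direction, so \<open>i = j\<close>,
    or in opposite directions, so \<open>i = Suc j\<close> and \<open>Suc i = j\<close>, which is
    absurd.\<close>
  then have "vs ! i = vs ! j \<or> vs ! i = vs ! Suc j \<and> vs ! Suc i = vs ! j"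
    by (auto simp: doubleton_eq_iff)
  then show False using ij joins_nth_eq_iff[OF assms, of i j] joins_nth_eq_iff[OF assms, of i "Suc j"]
      joins_nth_eq_iff[OF assms, of "Suc i" j] by auto
qed

lemma joins_rev:
  assumes "joins G u w vs es" shows "joins G w u (rev vs) (rev es)"
proof -
  note * = joinsD[OF assms]
  have "ends G (rev es ! i) = {rev vs ! i, rev vs ! Suc i}" if "i < length es" for i
  proof -
    have "rev es ! i = es ! (length es - Suc i)" "rev vs ! i = vs ! Suc (length es - Suc i)"
      "rev vs ! Suc i = vs ! (length es - Suc i)"
      using that *(1) by (auto simp: rev_nth Suc_diff_Suc)
    then show ?thesis using *(5)[of "length es - Suc i"] that by auto
  qed
  then show ?thesis using * by (auto simp: joins_def is_path_def rev_nth)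
qed

text \<open>A subdivision prescribes the ends of its paths only as unordered pairs; the path is
  reversed where its orientation is wrong.\<close>

lemma is_path_joins:
  assumes "is_path G vs es" "es \<noteq> []" "{hd vs, last vs} = {a, b}"
  shows "\<exists>vs' es'. joins G a b vs' es' \<and> set es' = set es \<and> length es' = length es \<and>
    inner_verts vs' = inner_verts vs"
proof -
  have len: "length vs = Suc (length es)" using assms by (simp add: is_path_def)
  then have "vs \<noteq> []" by auto
  then have "joins G (hd vs) (last vs) vs es"
    using assms len by (simp add: joins_def hd_conv_nth last_conv_nth)
  moreover have "hd vs = a \<and> last vs = b \<or> hd vs = b \<and> last vs = a"
    using assms(3) by (auto simp: doubleton_eq_iff)
  ultimately show ?thesis using joins_rev inner_verts_rev by (metis length_rev set_rev)
qed

text \<open>The vertex \<open>v\<close> ends the first list and begins the second, so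
  \<open>tl\<close> drops its second copy. This merges the two subdivided edges at the third branch
  vertex of the triangle into one path.\<close>

lemma joins_append:
  assumes 1: "joins G u v vs es" and 2: "joins G v w vs' es'"
    and "inner_verts vs \<inter> inner_verts vs' = {}" "u \<notin> set vs'" "w \<notin> set vs"
  shows "joins G u w (vs @ tl vs') (es @ es')"
    and "inner_verts (vs @ tl vs') = inner_verts vs \<union> {v} \<union> inner_verts vs'"
proof -
  note a = joinsD[OF 1] and b = joinsD[OF 2]
  have vs': "vs' = v # tl vs'" using b(1,7) by (cases vs') auto
  have tl: "set (tl vs') = {w} \<union> inner_verts vs'"
  proof -
    have "set vs' = insert v (set (tl vs'))" "v \<notin> set (tl vs')"
      using vs' b(2) by (metis list.simps(15), metis distinct.simps(2))
    then show ?thesis using b(9-12) by auto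
  qed
  have lt: "(vs @ tl vs') ! i = vs ! i" if "i \<le> length es" for i
    using that a(1) by (simp add: nth_append)
  have ge: "(vs @ tl vs') ! (length es + i) = vs' ! i" if "i \<le> length es'" for i
  proof (cases i)
    case 0 then show ?thesis using lt[of "length es"] a b by simp
  next
    case (Suc j)
    then have "(vs @ tl vs') ! (length es + i) = tl vs' ! j" using a(1) by (simp add: nth_append)
    then show ?thesis using vs' Suc by (metis nth_Cons_Suc)
  qed
  have "ends G ((es @ es') ! i) = {(vs @ tl vs') ! i, (vs @ tl vs') ! Suc i}"
    if "i < length (es @ es')" for i
  proof (cases "i < length es")
    case True then show ?thesis using a(5) lt by (simp add: nth_append)
  next
    case False
    then obtain k where k: "i = length es + k" using le_Suc_ex not_less by blast
    then have "k < length es'" using that by simp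
    then show ?thesis using b(5)[of k] ge[of k] ge[of "Suc k"] k by (simp add: nth_append)
  qed
  moreover have "distinct (vs @ tl vs')"
    using a(2,10) b(2,10,11,12) tl assms(3-5) by (auto simp: distinct_tl)
  moreover have "length (vs @ tl vs') = Suc (length (es @ es'))" using a(1) b(1) by simp
  moreover have "set (tl vs') \<subseteq> verts G" using b(3) vs' by (metis list.set_sel(2) list.distinct(1) subset_iff)
  ultimately show j: "joins G u w (vs @ tl vs') (es @ es')"
    using a b lt[of 0] ge[of "length es'"] unfolding joins_def is_path_def by auto
  have eq: "{u, w} \<union> inner_verts (vs @ tl vs') = {u, v, w} \<union> inner_verts vs \<union> inner_verts vs'"
    using joinsD(10)[OF j] a(10) tl by auto
  \<comment> \<open>Inner vertices are recovered from the vertex set of a path by deleting its two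
    ends.\<close>
  have cancel: "X = Y" if "{u, w} \<union> X = {u, w} \<union> Y" "u \<notin> X" "w \<notin> X" "u \<notin> Y" "w \<notin> Y" for X Y
  proof -
    have "X = ({u, w} \<union> X) - {u, w}" "Y = ({u, w} \<union> Y) - {u, w}" using that(2-5) by auto
    then show ?thesis using that(1) by metis
  qed
  show "inner_verts (vs @ tl vs') = inner_verts vs \<union> {v} \<union> inner_verts vs'"
    by (rule cancel) (use eq joinsD(11,12)[OF j] a(9-12) b(9-12) assms(4,5) in auto)
qed

text \<open>The cycle runs from \<open>u\<close> to \<open>w\<close> along the first path and
  returns along the reverse of the second.\<close>

lemma joins_graph_cycle:
  assumes 1: "joins G u w vs es" and 2: "joins G u w vs' es'"
    and "inner_verts vs \<inter> inner_verts vs' = {}" and es: "set es \<inter> set es' = {}"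
  shows "graph_cycle G (set es \<union> set es')"
proof -
  define ws ds where "ws = rev vs'" and "ds = rev es'"
  have 3: "joins G w u ws ds" using joins_rev[OF 2] by (simp add: ws_def ds_def)
  have inner: "inner_verts vs \<inter> inner_verts ws = {}" using assms by (simp add: ws_def inner_verts_rev)
  note a = joinsD[OF 1] and b = joinsD[OF 3]
  define n m where "n = length es" and "m = length ds"
  \<comment> \<open>The last vertex of each path is the first of the other, so
    \<open>butlast\<close> keeps exactly one vertex per edge.\<close>
  define xs where "xs = butlast vs @ butlast ws"
  have len: "length xs = n + m" using a b by (simp add: xs_def n_def m_def)
  have lt: "xs ! i = vs ! i" if "i < n" for i
    using that a(1) by (simp add: xs_def n_def nth_append nth_butlast)
  have ge: "xs ! (n + i) = ws ! i" if "i < m" for i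
    using that a(1) b(1) by (simp add: xs_def n_def m_def nth_append nth_butlast)
  have set1: "set (butlast vs) = {u} \<union> inner_verts vs"
  proof -
    have "vs \<noteq> []" using a(1) by auto
    then have "vs = butlast vs @ [w]" using a(1,8) by (metis append_butlast_last_id diff_Suc_1 last_conv_nth)
    then have "set vs = insert w (set (butlast vs))" "w \<notin> set (butlast vs)"
      using a(2) by (metis set_append Un_insert_right list.set sup_bot_right, metis distinct_append list.set_intros(1) disjoint_iff)
    then show ?thesis using a(9-12) by auto
  qed
  have set2: "set (butlast ws) = {w} \<union> inner_verts ws"
  proof -
    have "ws \<noteq> []" using b(1) by auto
    then have "ws = butlast ws @ [u]" using b(1,8) by (metis append_butlast_last_id diff_Suc_1 last_conv_nth)
    then have "set ws = insert u (set (butlast ws))" "u \<notin> set (butlast ws)"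
      using b(2) by (metis set_append Un_insert_right list.set sup_bot_right, metis distinct_append list.set_intros(1) disjoint_iff)
    then show ?thesis using b(9-12) by auto
  qed
  have dist: "distinct xs"
    using a(2,9-12) b(2,9-12) set1 set2 inner by (auto simp: xs_def distinct_butlast)
  \<comment> \<open>Two indices are critical: after the last edge of the first path comes
    \<open>w\<close>, the start of \<open>ws\<close>, and after the very last edge the modulus leads
    back to \<open>u\<close>.\<close>
  have ends: "ends G ((es @ ds) ! i) = {xs ! i, xs ! (Suc i mod (n + m))}" if i: "i < n + m" for i
  proof (cases "i < n")
    case True
    have "xs ! (Suc i mod (n + m)) = vs ! Suc i"
    proof (cases "Suc i < n")
      case True then show ?thesis using lt by simp
    next
      case False
      then have "Suc i = n" using \<open>i < n\<close> by simp
      then show ?thesis using ge[of 0] a b by (simp add: n_def m_def)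
    qed
    then show ?thesis using lt True a(5) by (simp add: n_def nth_append)
  next
    case False
    then obtain k where k: "i = n + k" using le_Suc_ex not_less by blast
    have "xs ! (Suc i mod (n + m)) = ws ! Suc k"
    proof (cases "Suc k < m")
      case True then show ?thesis using ge[of "Suc k"] k by simp
    next
      case False
      then have "Suc k = m" using k i by simp
      moreover from this have "Suc i = n + m" using k by simp
      ultimately show ?thesis using lt[of 0] a(6,7) b(8) by (simp add: n_def m_def)
    qed
    then show ?thesis using ge[of k] k i b(5)[of k] by (simp add: n_def m_def nth_append)
  qed
  have "distinct (es @ ds)"
    using joins_distinct_edges[OF 1] joins_distinct_edges[OF 3] es by (simp add: ds_def)
  moreover have "set xs \<subseteq> verts G" using a(3) b(3) by (auto simp: xs_def dest: in_set_butlastD)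
  moreover have "set (es @ ds) \<subseteq> edges G" using a(4) b(4) by simp
  moreover have "2 \<le> length (es @ ds)" "length (es @ ds) = n + m"
    using a(6) b(6) unfolding n_def m_def length_append by linarith+
  moreover have "set es \<union> set es' = set (es @ ds)" by (simp add: ds_def)
  ultimately show ?thesis
    unfolding graph_cycle_def using len dist ends by (intro exI[of _ xs] exI[of _ "es @ ds"]) auto
qed

text \<open>A vertex on the cycle has exactly two of its edges, any other vertex none. This parity
  later determines all cycles of a theta graph.\<close>

lemma graph_cycle_even_degree:
  assumes "graph_cycle G C"
  shows "even (card {e \<in> C. v \<in> ends G e})"
proof -
  obtain vs es where *: "2 \<le> length es" "length vs = length es" "distinct vs" "distinct es"
    and ends: "\<And>i. i < length es \<Longrightarrow> ends G (es ! i) = {vs ! i, vs ! (Suc i mod length es)}"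
    and C: "C = set es"
    using assms unfolding graph_cycle_def by blast
  define n where "n = length es"
  show ?thesis
  proof (cases "v \<in> set vs")
    case False
    have "{e \<in> C. v \<in> ends G e} = {}"
    proof (rule ccontr)
      assume "{e \<in> C. v \<in> ends G e} \<noteq> {}"
      then obtain i where i: "i < n" "v \<in> ends G (es ! i)" unfolding C n_def by (auto simp: in_set_conv_nth)
      moreover have "Suc i mod n < n" using i by (intro mod_less_divisor) simp
      ultimately have "v \<in> set vs" using ends[of i] *(2) by (auto simp: n_def)
      then show False using False by simp
    qed
    then show ?thesis by (metis card.empty even_zero)
  next
    case True
    then obtain i where i: "i < n" "v = vs ! i" using *(2) by (auto simp: in_set_conv_nth n_def)
    \<comment> \<open>The cyclic predecessor of \<open>i\<close>; it differs from \<open>i\<close>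
      because the cycle has length at least 2.\<close>
    define j where "j = (if i = 0 then n - 1 else i - 1)"
    have j: "j < n" "j \<noteq> i" "Suc j mod n = i" using i *(1) by (auto simp: j_def n_def)
    have uniq: "k = j" if "k < n" "Suc k mod n = i" for k
      using that i by (cases "Suc k = n") (auto simp: j_def)
    have "{e \<in> C. v \<in> ends G e} = {es ! i, es ! j}"
    proof (intro set_eqI iffI)
      fix e assume "e \<in> {e \<in> C. v \<in> ends G e}"
      then obtain k where k: "k < n" "e = es ! k" "v \<in> {vs ! k, vs ! (Suc k mod n)}"
        using ends unfolding C n_def by (auto simp: in_set_conv_nth)
      have "Suc k mod n < n" using k by simp
      then have "i = k \<or> i = Suc k mod n"
        using k i nth_eq_iff_index_eq[OF *(3)] *(2) by (auto simp: n_def)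
      then show "e \<in> {es ! i, es ! j}" using uniq k by auto
    next
      fix e assume "e \<in> {es ! i, es ! j}"
      then show "e \<in> {e \<in> C. v \<in> ends G e}" using ends[of i] ends[of j] i j C by (auto simp: n_def)
    qed
    moreover have "es ! i \<noteq> es ! j" using nth_eq_iff_index_eq[OF *(4)] i j by (auto simp: n_def)
    ultimately show ?thesis by simp
  qed
qed

text \<open>Edge disjointness is a separate assumption, since two paths without inner vertices could
  be the same single edge.\<close>

locale theta_graph =
  fixes G :: "('v, 'e) graph" and u w :: 'v and vs :: "nat \<Rightarrow> 'v list" and es :: "nat \<Rightarrow> 'e list"
  assumes joins: "i < 3 \<Longrightarrow> joins G u w (vs i) (es i)"
    and inner_disjoint: "i < 3 \<Longrightarrow> j < 3 \<Longrightarrow> i \<noteq> j \<Longrightarrow> inner_verts (vs i) \<inter> inner_verts (vs j) = {}"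
    and edge_disjoint: "i < 3 \<Longrightarrow> j < 3 \<Longrightarrow> i \<noteq> j \<Longrightarrow> set (es i) \<inter> set (es j) = {}"
    and edges: "edges G = (\<Union>i<3. set (es i))"
begin

section \<open>Determination of all cycles of a theta graph\<close>

lemma inner_edges:
  assumes "i < 3" "Suc k < length (es i)" "e \<in> edges G" "vs i ! Suc k \<in> ends G e"
  shows "e = es i ! k \<or> e = es i ! Suc k"
proof -
  obtain j l where j: "j < 3" "l < length (es j)" "e = es j ! l"
    using assms(3) edges by (auto simp: in_set_conv_nth)
  note a = joinsD[OF joins[OF assms(1)]] and b = joinsD[OF joins[OF j(1)]]
  have inner: "vs i ! Suc k \<in> inner_verts (vs i)"
    using assms(2) inner_verts_conv_nth[OF a(1)] by auto
  have v: "vs i ! Suc k = vs j ! l \<or> vs i ! Suc k = vs j ! Suc l" using assms(4) b(5) j by auto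
  then have "vs i ! Suc k \<in> set (vs j)" using j b(1) by auto
  then have "vs i ! Suc k \<in> inner_verts (vs j)" using inner a(11,12) b(10) by auto
  then have "i = j" using inner inner_disjoint[OF assms(1) j(1)] by blast
  then show ?thesis using v j joins_nth_eq_iff[OF joins[OF assms(1)]] assms(2) by auto
qed

lemma end_edges:
  assumes "e \<in> edges G" "u \<in> ends G e"
  shows "\<exists>i<3. e = es i ! 0"
proof -
  obtain j l where j: "j < 3" "l < length (es j)" "e = es j ! l"
    using assms(1) edges by (auto simp: in_set_conv_nth)
  note b = joinsD[OF joins[OF j(1)]]
  have "vs j ! 0 = vs j ! l \<or> vs j ! 0 = vs j ! Suc l" using assms(2) b(5,7) j by auto
  then have "l = 0" using joins_nth_eq_iff[OF joins[OF j(1)]] j by auto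
  then show ?thesis using j by blast
qed

text \<open>An inner vertex of a path meets only two edges, and even degree forces a cycle to use
  both or neither. This propagates along the path.\<close>

lemma graph_cycle_all_or_nothing:
  assumes C: "graph_cycle G C" and i: "i < 3" and k: "k < length (es i)"
  shows "es i ! k \<in> C \<longleftrightarrow> es i ! 0 \<in> C"
  using k
proof (induction k)
  case (Suc k)
  note a = joinsD[OF joins[OF i]]
  have sub: "C \<subseteq> edges G" using C by (auto simp: graph_cycle_def)
  have "{e \<in> C. vs i ! Suc k \<in> ends G e} = C \<inter> {es i ! k, es i ! Suc k}"
    using inner_edges[OF i Suc.prems] sub a(5)[of k] a(5)[of "Suc k"] Suc.prems by auto
  then have "even (card (C \<inter> {es i ! k, es i ! Suc k}))"
    using graph_cycle_even_degree[OF C, of "vs i ! Suc k"] by simp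
  moreover have "es i ! k \<noteq> es i ! Suc k"
    using joins_distinct_edges[OF joins[OF i]] Suc.prems by (simp add: nth_eq_iff_index_eq)
  ultimately have "es i ! k \<in> C \<longleftrightarrow> es i ! Suc k \<in> C"
    by (cases "es i ! k \<in> C"; cases "es i ! Suc k \<in> C") (auto simp: Int_insert_right)
  then show ?case using Suc by simp
qed simp

text \<open>A cycle is a union of whole paths, and even degree at \<open>u\<close> makes their
  number even. As cycles are nonempty, exactly two paths remain.\<close>

lemma graph_cycle_iff:
  "graph_cycle G C \<longleftrightarrow> C = set (es 0) \<union> set (es 1) \<or> C = set (es 0) \<union> set (es 2) \<or> C = set (es 1) \<union> set (es 2)"
proof
  assume "C = set (es 0) \<union> set (es 1) \<or> C = set (es 0) \<union> set (es 2) \<or> C = set (es 1) \<union> set (es 2)"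
  moreover have "graph_cycle G (set (es i) \<union> set (es j))" if "i < 3" "j < 3" "i \<noteq> j" for i j
    using joins_graph_cycle[OF joins joins inner_disjoint edge_disjoint] that by blast
  ultimately show "graph_cycle G C" by auto
next
  assume C: "graph_cycle G C"
  then have sub: "C \<subseteq> edges G" and ne: "C \<noteq> {}" by (auto simp: graph_cycle_def)
  \<comment> \<open>By the all-or-nothing property, the first edge decides whether the whole path is
    used.\<close>
  define q where "q i \<longleftrightarrow> es i ! 0 \<in> C" for i
  have part: "C \<inter> set (es i) = (if q i then set (es i) else {})" if "i < 3" for i
    using graph_cycle_all_or_nothing[OF C that] by (auto simp: in_set_conv_nth q_def)
  have three: "{..<3} = {0, 1, 2::nat}" by auto
  have "C = (C \<inter> set (es 0)) \<union> (C \<inter> set (es 1)) \<union> (C \<inter> set (es 2))"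
    using sub edges unfolding three by auto
  then have Ceq: "C = (if q 0 then set (es 0) else {}) \<union> (if q 1 then set (es 1) else {}) \<union>
    (if q 2 then set (es 2) else {})"
    using part[of 0] part[of 1] part[of 2] by simp
  have mem: "es i ! 0 \<in> set (es i)" "u \<in> ends G (es i ! 0)" if "i < 3" for i
    using joinsD(5,6,7)[OF joins[OF that]] by auto
  have d: "es i ! 0 \<noteq> es j ! 0" if "i < 3" "j < 3" "i \<noteq> j" for i j
    using mem that edge_disjoint[OF that] by (metis disjoint_iff)
  have "{e \<in> C. u \<in> ends G e} = C \<inter> {es 0 ! 0, es 1 ! 0, es 2 ! 0}"
  proof -
    have "e \<in> {es 0 ! 0, es 1 ! 0, es 2 ! 0}" if e: "e \<in> C" "u \<in> ends G e" for e
    proof -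
      obtain i where "i < 3" "e = es i ! 0" using end_edges[of e] sub e by blast
      then show ?thesis by (auto simp: less_Suc_eq numeral_3_eq_3 numeral_2_eq_2)
    qed
    then show ?thesis using mem(2)[of 0] mem(2)[of 1] mem(2)[of 2] by auto
  qed
  then have "even (card (C \<inter> {es 0 ! 0, es 1 ! 0, es 2 ! 0}))"
    using graph_cycle_even_degree[OF C, of u] by simp
  moreover have "card (C \<inter> {a, b, c}) = of_bool (a \<in> C) + of_bool (b \<in> C) + of_bool (c \<in> C)"
    if "a \<noteq> b" "a \<noteq> c" "b \<noteq> c" for a b c
    using that by (cases "a \<in> C"; cases "b \<in> C"; cases "c \<in> C") (simp_all add: Int_insert_right)
  ultimately have "even (of_bool (q 0) + of_bool (q 1) + of_bool (q 2) :: nat)"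
    using d[of 0 1] d[of 0 2] d[of 1 2] by (simp add: q_def)
  then have "\<not> (q 0 \<and> \<not> q 1 \<and> \<not> q 2)" "\<not> (\<not> q 0 \<and> q 1 \<and> \<not> q 2)" "\<not> (\<not> q 0 \<and> \<not> q 1 \<and> q 2)"
    "\<not> (q 0 \<and> q 1 \<and> q 2)"
    by auto
  then show "C = set (es 0) \<union> set (es 1) \<or> C = set (es 0) \<union> set (es 2) \<or> C = set (es 1) \<union> set (es 2)"
    using Ceq ne by (cases "q 0"; cases "q 1"; cases "q 2") simp_all
qed

end

section \<open>Subdivisions of the triangle with a doubled edge\<close>

text \<open>The existential witnesses of \<open>totally_odd_subdivision\<close> are made arguments,
  so that the paths can be referred to.\<close>

definition odd_subdivision_by ::
  "('v, 'e) graph \<Rightarrow> ('w, 'd) graph \<Rightarrow> ('v \<Rightarrow> 'w) \<Rightarrow> ('e \<Rightarrow> 'w list) \<Rightarrow> ('e \<Rightarrow> 'd list) \<Rightarrow> bool" where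
  "odd_subdivision_by H G f P Q \<longleftrightarrow>
     inj_on f (verts H) \<and>
     (\<forall>e\<in>edges H. is_path G (P e) (Q e) \<and> odd (length (Q e)) \<and>
         {hd (P e), last (P e)} = f ` ends H e \<and>
         inner_verts (P e) \<inter> f ` verts H = {}) \<and>
     (\<forall>e\<in>edges H. \<forall>e'\<in>edges H. e \<noteq> e' \<longrightarrow>
         inner_verts (P e) \<inter> inner_verts (P e') = {} \<and> set (Q e) \<inter> set (Q e') = {}) \<and>
     verts G = f ` verts H \<union> (\<Union>e\<in>edges H. inner_verts (P e)) \<and>
     edges G = (\<Union>e\<in>edges H. set (Q e))"

lemma totally_odd_subdivision_iff:
  "totally_odd_subdivision H G \<longleftrightarrow> is_graph G \<and> (\<exists>f P Q. odd_subdivision_by H G f P Q)"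
  by (simp add: totally_odd_subdivision_def odd_subdivision_by_def)

section \<open>An odd subdivision as a theta graph\<close>

lemma C3_plus_simps:
  "verts C3_plus = {0, 1, 2}" "edges C3_plus = {0, 1, 2, 3}"
  "ends C3_plus 0 = {0, 1}" "ends C3_plus 1 = {1, 2}" "ends C3_plus 2 = {2, 0}" "ends C3_plus 3 = {0, 1}"
  by (simp_all add: C3_plus_def)

text \<open>Between branch vertices 0 and 1 run three paths: the two subdivided parallel edges 0 and
  3, and the detour \<open>R\<close> through branch vertex 2. Hence the subdivision is a theta
  graph.\<close>

lemma odd_C3_plus_cycles:
  assumes sub: "odd_subdivision_by C3_plus G f P Q"
  defines "R \<equiv> set (Q 1) \<union> set (Q 2)"
  shows "graph_cycle G C \<longleftrightarrow> C = set (Q 0) \<union> set (Q 3) \<or> C = set (Q 0) \<union> R \<or> C = set (Q 3) \<union> R"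
    and "edges G = set (Q 0) \<union> set (Q 3) \<union> R"
    and "set (Q 0) \<inter> set (Q 3) = {}" "set (Q 0) \<inter> R = {}" "set (Q 3) \<inter> R = {}"
    and "e < 4 \<Longrightarrow> card (set (Q e)) = length (Q e)"
    and "card R = length (Q 1) + length (Q 2)"
    and "e < 4 \<Longrightarrow> odd (length (Q e))"
proof -
  have E: "e \<in> edges C3_plus" if "e < 4" for e using that by (auto simp: C3_plus_simps)
  have data: "\<forall>e\<in>edges C3_plus. is_path G (P e) (Q e) \<and> odd (length (Q e)) \<and>
      {hd (P e), last (P e)} = f ` ends C3_plus e \<and> inner_verts (P e) \<inter> f ` verts C3_plus = {}"
    and data2: "\<forall>e\<in>edges C3_plus. \<forall>e'\<in>edges C3_plus. e \<noteq> e' \<longrightarrow>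
      inner_verts (P e) \<inter> inner_verts (P e') = {} \<and> set (Q e) \<inter> set (Q e') = {}"
    using sub unfolding odd_subdivision_by_def by metis+
  have path: "is_path G (P e) (Q e)" and odd: "odd (length (Q e))"
    and hl: "{hd (P e), last (P e)} = f ` ends C3_plus e"
    and inner: "inner_verts (P e) \<inter> f ` {0, 1, 2} = {}" if "e < 4" for e
    using bspec[OF data E[OF that]] unfolding C3_plus_simps(1) by simp_all
  have disj: "inner_verts (P e) \<inter> inner_verts (P e') = {}" "set (Q e) \<inter> set (Q e') = {}"
    if "e < 4" "e' < 4" "e \<noteq> e'" for e e'
    using bspec[OF bspec[OF data2 E[OF that(1)]] E[OF that(2)]] that(3) by simp_all
  have inj: "f 0 \<noteq> f 1" "f 0 \<noteq> f 2" "f 1 \<noteq> f 2"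
    using sub by (auto simp: odd_subdivision_by_def C3_plus_simps inj_on_def)
  have edges_eq: "edges G = set (Q 0) \<union> set (Q 3) \<union> R"
    using sub unfolding odd_subdivision_by_def C3_plus_simps R_def by auto
  have ne: "Q e \<noteq> []" if "e < 4" for e using odd[OF that] by auto
  have path': "\<exists>vs es. joins G a b vs es \<and> set es = set (Q e) \<and> length es = length (Q e) \<and>
      inner_verts vs = inner_verts (P e)"
    if "e < 4" "f ` ends C3_plus e = {a, b}" for e a b
    by (rule is_path_joins[OF path[OF that(1)] ne[OF that(1)]]) (simp add: hl that)
  obtain v0 e0 where 0: "joins G (f 0) (f 1) v0 e0" "set e0 = set (Q 0)" "length e0 = length (Q 0)"
      "inner_verts v0 = inner_verts (P 0)"
    using path'[of 0 "f 0" "f 1"] by (auto simp: C3_plus_simps)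
  obtain v3 e3 where 3: "joins G (f 0) (f 1) v3 e3" "set e3 = set (Q 3)" "length e3 = length (Q 3)"
      "inner_verts v3 = inner_verts (P 3)"
    using path'[of 3 "f 0" "f 1"] by (auto simp: C3_plus_simps)
  \<comment> \<open>Edges 2 and 1 are oriented so that they can be concatenated from
    \<open>f 0\<close> by way of \<open>f 2\<close> to \<open>f 1\<close>.\<close>
  have "f ` ends C3_plus 2 = {f 0, f 2}" by (auto simp: C3_plus_simps)
  then obtain v2 e2 where 2: "joins G (f 0) (f 2) v2 e2" "set e2 = set (Q 2)" "length e2 = length (Q 2)"
      "inner_verts v2 = inner_verts (P 2)"
    using path'[of 2 "f 0" "f 2"] by auto
  have "f ` ends C3_plus 1 = {f 2, f 1}" unfolding C3_plus_simps by auto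
  then obtain v1 e1 where 1: "joins G (f 2) (f 1) v1 e1" "set e1 = set (Q 1)" "length e1 = length (Q 1)"
      "inner_verts v1 = inner_verts (P 1)"
    using path'[of 1 "f 2" "f 1"] by auto
  have "f 0 \<notin> set v1" "f 1 \<notin> set v2"
    using joinsD(10)[OF 1(1)] joinsD(10)[OF 2(1)] inner[of 1] inner[of 2] inj 1 2 by auto
  moreover have "inner_verts v2 \<inter> inner_verts v1 = {}" using 1 2 disj[of 2 1] by simp
  ultimately have j: "joins G (f 0) (f 1) (v2 @ tl v1) (e2 @ e1)"
    and i: "inner_verts (v2 @ tl v1) = inner_verts v2 \<union> {f 2} \<union> inner_verts v1"
    using joins_append[OF 2(1) 1(1)] by auto
  have setR: "set (e2 @ e1) = R" using 1 2 by (auto simp: R_def)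
  show dj: "set (Q 0) \<inter> set (Q 3) = {}" "set (Q 0) \<inter> R = {}" "set (Q 3) \<inter> R = {}"
    using disj(2)[of 0 3] disj(2)[of 0 1] disj(2)[of 0 2] disj(2)[of 3 1] disj(2)[of 3 2]
    by (auto simp: R_def)
  define vs where "vs i = [v0, v3, v2 @ tl v1] ! i" for i :: nat
  define es where "es i = [e0, e3, e2 @ e1] ! i" for i :: nat
  have vs: "vs 0 = v0" "vs 1 = v3" "vs 2 = v2 @ tl v1" and es: "es 0 = e0" "es 1 = e3" "es 2 = e2 @ e1"
    by (simp_all add: vs_def es_def)
  have lt3: "i = 0 \<or> i = 1 \<or> i = 2" if "i < 3" for i :: nat using that by auto
  have in0: "inner_verts v0 \<inter> inner_verts v3 = {}" using disj(1)[of 0 3] 0 3 by simp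
  \<comment> \<open>The new inner vertex \<open>f 2\<close> of the detour is a branch vertex and
    hence not an inner vertex of another subdivided edge.\<close>
  have in1: "inner_verts v0 \<inter> inner_verts (v2 @ tl v1) = {}"
    using disj(1)[of 0 1] disj(1)[of 0 2] inner[of 0] 0 1 2 i by auto
  have in2: "inner_verts v3 \<inter> inner_verts (v2 @ tl v1) = {}"
    using disj(1)[of 3 1] disj(1)[of 3 2] inner[of 3] 3 1 2 i by auto
  interpret theta_graph G "f 0" "f 1" vs es
  proof
    show "joins G (f 0) (f 1) (vs i) (es i)" if "i < 3" for i
      using lt3[OF that] vs es 0 3 j by auto
    show "inner_verts (vs i) \<inter> inner_verts (vs k) = {}" if "i < 3" "k < 3" "i \<noteq> k" for i k
      using lt3[OF that(1)] lt3[OF that(2)] that(3) vs in0 in1 in2 by (elim disjE) (simp_all add: Int_commute)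
    show "set (es i) \<inter> set (es k) = {}" if "i < 3" "k < 3" "i \<noteq> k" for i k
      using lt3[OF that(1)] lt3[OF that(2)] that(3) dj 0(2) 3(2) setR
      by (elim disjE) (simp_all only: es Int_commute simp_thms)
    have "{..<3} = {0, 1, 2::nat}" by auto
    then have "(\<Union>i<3. set (es i)) = set (es 0) \<union> set (es 1) \<union> set (es 2)" by auto
    then show "edges G = (\<Union>i<3. set (es i))" unfolding es setR 0(2) 3(2) edges_eq by simp
  qed
  show "graph_cycle G C \<longleftrightarrow> C = set (Q 0) \<union> set (Q 3) \<or> C = set (Q 0) \<union> R \<or> C = set (Q 3) \<union> R"
    unfolding graph_cycle_iff es setR 0(2) 3(2) by blast
  show "edges G = set (Q 0) \<union> set (Q 3) \<union> R" by (fact edges_eq)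
  show "odd (length (Q e))" if "e < 4" by (fact odd[OF that])
  show "card R = length (Q 1) + length (Q 2)"
    using distinct_card[OF joins_distinct_edges[OF j]] setR 1 2 by simp
  show "card (set (Q e)) = length (Q e)" if e: "e < 4"
  proof -
    obtain vs es where *: "joins G (hd (P e)) (last (P e)) vs es" "set es = set (Q e)"
        "length es = length (Q e)"
      using path'[OF e hl[OF e, symmetric]] by blast
    then show ?thesis using distinct_card[OF joins_distinct_edges[OF *(1)]] by simp
  qed
qed

text \<open>
  Edge \<open>e\<close> of \<open>C\<^sub>3\<^sup>+\<close> becomes a path of length \<open>l e\<close> whose \<open>i\<close>-th vertex is \<open>sub_vert l e i\<close>; the two
  lists give the tails and heads of the four edges, and the shift by 3 keeps inner vertices apart
  from the branch vertices.
\<close>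

definition sub_vert :: "(nat \<Rightarrow> nat) \<Rightarrow> nat \<Rightarrow> nat \<Rightarrow> nat" where
  "sub_vert l e i = (if i = 0 then [0, 1, 2, 0] ! e else if i = l e then [1, 2, 0, 1] ! e
     else 3 + prod_encode (e, i))"

definition sub_graph :: "(nat \<Rightarrow> nat) \<Rightarrow> (nat, nat) graph" where
  "sub_graph l = \<lparr>verts = {0, 1, 2} \<union> {sub_vert l e i | e i. e < 4 \<and> 0 < i \<and> i < l e},
     edges = {prod_encode (e, i) | e i. e < 4 \<and> i < l e},
     ends = (\<lambda>x. case prod_decode x of (e, i) \<Rightarrow> {sub_vert l e i, sub_vert l e (Suc i)})\<rparr>"

section \<open>Realising prescribed odd path lengths\<close>

lemma inj_on_image_subset_iff:
  assumes "inj_on g X" "Y \<subseteq> X" "Z \<subseteq> X"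
  shows "g ` Z \<subseteq> g ` Y \<longleftrightarrow> Z \<subseteq> Y"
proof -
  have "g x \<in> g ` Y \<longleftrightarrow> x \<in> Y" if "x \<in> Z" for x
    using inj_on_image_mem_iff[OF assms(1)] that assms(2,3) by blast
  then show ?thesis unfolding image_subset_iff by blast
qed

lemma less_4_cases: "(e::nat) < 4 \<Longrightarrow> e = 0 \<or> e = 1 \<or> e = 2 \<or> e = 3"
  by auto

lemma sub_vert_inj:
  assumes "e < 4" shows "inj_on (sub_vert l e) {..l e}"
proof -
  have "[0, 1, 2, 0] ! e < (3::nat)" "[1, 2, 0, 1] ! e < (3::nat)" "[0, 1, 2, 0] ! e \<noteq> ([1, 2, 0, 1] ! e :: nat)"
    using less_4_cases[OF assms] by auto
  then show ?thesis by (auto simp: inj_on_def sub_vert_def)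
qed

lemma sub_graph_subdivision:
  assumes "\<forall>e<4. odd (l e)"
  shows "is_graph (sub_graph l)"
    and "odd_subdivision_by C3_plus (sub_graph l) id
      (\<lambda>e. map (sub_vert l e) [0..<Suc (l e)]) (\<lambda>e. map (\<lambda>i. prod_encode (e, i)) [0..<l e])"
proof -
  \<comment> \<open>Positive length keeps the head at index \<open>l e\<close> from being overridden
    by the clause \<open>i = 0\<close> of \<open>sub_vert\<close>.\<close>
  have pos: "0 < l e" if "e < 4" for e using assms that by (intro odd_pos) blast
  have branch: "sub_vert l e 0 \<in> {0, 1, 2}" "sub_vert l e (l e) \<in> {0, 1, 2}" if "e < 4" for e
    using less_4_cases[OF that] pos[OF that] by (auto simp: sub_vert_def)
  have vert: "sub_vert l e i \<in> verts (sub_graph l)" if "e < 4" "i \<le> l e" for e i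
  proof (cases "i = 0 \<or> i = l e")
    case True then show ?thesis using branch[OF that(1)] unfolding sub_graph_def by auto
  next
    case False
    then have "0 < i \<and> i < l e" using that by auto
    then show ?thesis using that(1) unfolding sub_graph_def by (simp, blast)
  qed
  have ends: "ends (sub_graph l) (prod_encode (e, i)) = {sub_vert l e i, sub_vert l e (Suc i)}" for e i
    by (simp add: sub_graph_def)
  have "{sub_vert l e i | e i. e < 4 \<and> 0 < i \<and> i < l e} \<subseteq> (\<Union>e<4. sub_vert l e ` {..<l e})" by auto
  then have "finite {sub_vert l e i | e i. e < 4 \<and> 0 < i \<and> i < l e}" by (rule finite_subset) auto
  then have finv: "finite (verts (sub_graph l))" by (simp add: sub_graph_def)
  have edges: "edges (sub_graph l) = (\<Union>e<4. (\<lambda>i. prod_encode (e, i)) ` {..<l e})"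
    by (auto simp: sub_graph_def)
  show "is_graph (sub_graph l)"
    unfolding is_graph_def
  proof (intro conjI ballI finv)
    fix x assume "x \<in> edges (sub_graph l)"
    then obtain e i where x: "x = prod_encode (e, i)" "e < 4" "i < l e" by (auto simp: sub_graph_def)
    show "ends (sub_graph l) x \<subseteq> verts (sub_graph l)" using x vert by (simp add: ends)
    have "sub_vert l e i \<noteq> sub_vert l e (Suc i)"
      using inj_onD[OF sub_vert_inj[OF x(2)], of l i "Suc i"] x(3) by auto
    then show "card (ends (sub_graph l) x) = 2" using x by (simp add: ends)
  qed (simp add: edges)
  have inner: "inner_verts (map (sub_vert l e) [0..<Suc (l e)]) = {sub_vert l e i | i. 0 < i \<and> i < l e}" for e
  proof -
    have "map (sub_vert l e) [0..<Suc (l e)] ! i = sub_vert l e i" if "i < l e" for i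
      using that by (simp del: upt_Suc)
    then have "{map (sub_vert l e) [0..<Suc (l e)] ! i | i. 0 < i \<and> i < l e} =
        {sub_vert l e i | i. 0 < i \<and> i < l e}"
      by (intro Collect_cong) metis
    moreover have len: "length (map (sub_vert l e) [0..<Suc (l e)]) = Suc (l e)" by simp
    ultimately show ?thesis by (simp only: inner_verts_conv_nth[OF len])
  qed
  have high: "sub_vert l e i = 3 + prod_encode (e, i)" if "0 < i" "i < l e" for e i
    using that by (simp add: sub_vert_def)
  have lt4: "e < 4" if "e \<in> edges C3_plus" for e using that by (auto simp: C3_plus_simps)
  show "odd_subdivision_by C3_plus (sub_graph l) id
      (\<lambda>e. map (sub_vert l e) [0..<Suc (l e)]) (\<lambda>e. map (\<lambda>i. prod_encode (e, i)) [0..<l e])"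
    unfolding odd_subdivision_by_def
  proof (intro conjI ballI impI)
    fix e assume "e \<in> edges C3_plus"
    then have e: "e < 4" by (rule lt4)
    have "inj_on (sub_vert l e) {0..<Suc (l e)}"
      using sub_vert_inj[OF e] by (simp add: atLeast0LessThan lessThan_Suc_atMost)
    then show "is_path (sub_graph l) (map (sub_vert l e) [0..<Suc (l e)]) (map (\<lambda>i. prod_encode (e, i)) [0..<l e])"
      unfolding is_path_def using e vert ends
      by (auto simp: distinct_map edges nth_append simp del: upt_Suc)
    show "odd (length (map (\<lambda>i. prod_encode (e, i)) [0..<l e]))" using assms e by simp
    have "hd (map (sub_vert l e) [0..<Suc (l e)]) = sub_vert l e 0"
      "last (map (sub_vert l e) [0..<Suc (l e)]) = sub_vert l e (l e)"
      by (simp_all add: hd_map hd_append)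
    then show "{hd (map (sub_vert l e) [0..<Suc (l e)]), last (map (sub_vert l e) [0..<Suc (l e)])} =
        id ` ends C3_plus e"
      using less_4_cases[OF e] pos[OF e] by (auto simp: sub_vert_def C3_plus_def)
    show "inner_verts (map (sub_vert l e) [0..<Suc (l e)]) \<inter> id ` verts C3_plus = {}"
      unfolding inner by (auto simp: C3_plus_simps high)
  next
    fix e e' assume ee: "e \<in> edges C3_plus" "e' \<in> edges C3_plus" "e \<noteq> e'"
    show "inner_verts (map (sub_vert l e) [0..<Suc (l e)]) \<inter>
        inner_verts (map (sub_vert l e') [0..<Suc (l e')]) = {}"
      unfolding inner using ee(3) by (auto simp: high)
    show "set (map (\<lambda>i. prod_encode (e, i)) [0..<l e]) \<inter> set (map (\<lambda>i. prod_encode (e', i)) [0..<l e']) = {}"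
      using ee(3) by auto
  next
    have E: "edges C3_plus = {..<4}" by (auto simp: C3_plus_simps)
    show "verts (sub_graph l) = id ` verts C3_plus \<union>
        (\<Union>e\<in>edges C3_plus. inner_verts (map (sub_vert l e) [0..<Suc (l e)]))"
      unfolding inner E by (auto simp: C3_plus_simps(1) sub_graph_def)
    show "edges (sub_graph l) = (\<Union>e\<in>edges C3_plus. set (map (\<lambda>i. prod_encode (e, i)) [0..<l e]))"
      unfolding E edges by auto
  qed simp
qed

section \<open>The equivalence\<close>

context binary_cycles
begin

text \<open>The circuits \<open>Q 0\<close> with \<open>R\<close> and \<open>Q 3\<close> with
  \<open>R\<close> are odd and meet in \<open>R\<close>, whose size is even as a sum of two odd
  lengths. This contradicts (P).\<close>

lemma parity_form_imp_free:
  assumes pf: "parity_form (ground M)"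
  shows "odd_C3_plus_free M"
  unfolding odd_C3_plus_free_def
proof (intro notI, elim exE conjE)
  fix X and G :: "(nat, nat) graph"
  assume X: "X \<subseteq> ground M" and "odd_C3_plus_graph G" and iso: "matroid_iso (restriction M X) (circuit_matroid G)"
  then obtain f P Q where sub: "odd_subdivision_by C3_plus G f P Q"
    unfolding odd_C3_plus_graph_def totally_odd_subdivision_iff by blast
  obtain g where g: "bij_betw g X (edges G)"
    and ind': "\<And>Y. Y \<subseteq> X \<Longrightarrow>
      indep M Y \<longleftrightarrow> g ` Y \<subseteq> edges G \<and> (\<forall>K. K \<subseteq> g ` Y \<longrightarrow> \<not> graph_cycle G K)"
    using iso unfolding matroid_iso_def restriction_def circuit_matroid_def by auto
  have ind: "indep M Y \<longleftrightarrow> (\<forall>K. K \<subseteq> g ` Y \<longrightarrow> \<not> graph_cycle G K)" if "Y \<subseteq> X" for Y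
    using ind'[OF that] image_mono[OF that, of g] bij_betw_imp_surj_on[OF g] by simp
  define R where "R = set (Q 1) \<union> set (Q 2)"
  note c = odd_C3_plus_cycles[OF sub, folded R_def]
  \<comment> \<open>Edge sets are pulled back to the matroid along the isomorphism
    \<open>g\<close>.\<close>
  define pre where "pre K = {x \<in> X. g x \<in> K}" for K
  have im: "g ` pre K = K" if "K \<subseteq> edges G" for K
    using g that by (auto simp: pre_def bij_betw_def)
  have card: "card (pre K) = card K" if "K \<subseteq> edges G" for K
  proof -
    have "inj_on g (pre K)" using g by (auto simp: bij_betw_def inj_on_def pre_def)
    then show ?thesis using card_image im[OF that] by metis
  qed
  \<comment> \<open>A graph cycle without a smaller one inside is a minimal dependent set of the
    circuit matroid, and this transfers to its preimage.\<close>
  have circuit: "pre K \<in> \<C>" if K: "graph_cycle G K" "\<And>L. graph_cycle G L \<Longrightarrow> L \<subseteq> K \<Longrightarrow> L = K" for K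
  proof -
    have KG: "K \<subseteq> edges G" using K by (auto simp: graph_cycle_def)
    have pX: "pre K \<subseteq> X" by (auto simp: pre_def)
    have "circuit M (pre K)"
      unfolding circuit_def
    proof (intro conjI allI impI)
      show "pre K \<subseteq> ground M" using pX X by blast
      show "\<not> indep M (pre K)" using ind[OF pX] im[OF KG] K by blast
      fix D assume D: "D \<subset> pre K"
      have "\<not> graph_cycle G L" if L: "L \<subseteq> g ` D" for L
      proof
        assume "graph_cycle G L"
        moreover have "g ` D \<subseteq> K" using D im[OF KG] by blast
        ultimately have "L = K" using K(2) L by blast
        then have "g ` pre K \<subseteq> g ` D" using L im[OF KG] by simp
        then have "pre K \<subseteq> D"
          using inj_on_image_subset_iff[OF bij_betw_imp_inj_on[OF g]] D pX by blast
        then show False using D by blast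
      qed
      then show "indep M D" using ind[of D] D pX by blast
    qed
    then show ?thesis using circuit_iff circD(1) by blast
  qed
  have fin: "finite (set (Q e))" for e by simp
  then have finR: "finite R" by (simp add: R_def)
  have "Q 0 \<noteq> []" "Q 3 \<noteq> []" using c(8)[of 0] c(8)[of 3] by auto
  \<comment> \<open>Each of \<open>x\<close> and \<open>y\<close> lies on two of the three graph
    cycles; avoiding it leaves only the third, which gives minimality.\<close>
  then obtain x y where xy: "x \<in> set (Q 0)" "y \<in> set (Q 3)" by (meson hd_in_set)
  then have x: "x \<notin> set (Q 3) \<union> R" and y: "y \<notin> set (Q 0) \<union> R" using c(3-5) by auto
  have "pre (set (Q 0) \<union> R) \<in> \<C>"
  proof (rule circuit)
    fix L assume "graph_cycle G L" "L \<subseteq> set (Q 0) \<union> R"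
    moreover from this have "y \<notin> L" using y by blast
    ultimately show "L = set (Q 0) \<union> R" unfolding c(1) using xy by blast
  qed (simp add: c(1))
  moreover have "pre (set (Q 3) \<union> R) \<in> \<C>"
  proof (rule circuit)
    fix L assume "graph_cycle G L" "L \<subseteq> set (Q 3) \<union> R"
    moreover from this have "x \<notin> L" using x by blast
    ultimately show "L = set (Q 3) \<union> R" unfolding c(1) using xy by blast
  qed (simp add: c(1))
  ultimately have "odd (card (pre (set (Q 0) \<union> R) \<inter> pre (set (Q 3) \<union> R))) \<longleftrightarrow>
      odd (card (pre (set (Q 0) \<union> R))) \<and> odd (card (pre (set (Q 3) \<union> R)))"
    using pf cycle_subset unfolding parity_form_def by blast
  moreover have "pre (set (Q 0) \<union> R) \<inter> pre (set (Q 3) \<union> R) = pre R" using c(3) by (auto simp: pre_def)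
  moreover have "card (pre R) = card R" "card (pre (set (Q 0) \<union> R)) = card (set (Q 0) \<union> R)"
    "card (pre (set (Q 3) \<union> R)) = card (set (Q 3) \<union> R)"
    using c(2) by (auto intro!: card)
  moreover have "card (set (Q 0) \<union> R) = card (set (Q 0)) + card R" "card (set (Q 3) \<union> R) = card (set (Q 3)) + card R"
    using c(4,5) finR by (auto intro!: card_Un_disjoint)
  moreover have "even (card R)" using c(7) c(8)[of 1] c(8)[of 2] by simp
  moreover have "odd (card (set (Q 0)))" "odd (card (set (Q 3)))"
    using c(6)[of 0] c(6)[of 3] c(8)[of 0] c(8)[of 3] by auto
  ultimately show False by simp
qed

text \<open>If the intersection were even, the theta would consist of parts of sizes odd, odd, and
  even but positive. Splitting the even part into two odd pieces exhibits it as an odd-C3+.\<close>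

lemma free_imp_odd_Int:
  assumes free: "odd_C3_plus_free M" and th: "theta C D" and odd: "odd (card C)" "odd (card D)"
  shows "odd (card (C \<inter> D))"
proof (rule ccontr)
  assume ev: "\<not> odd (card (C \<inter> D))"
  have c: "circ C" "circ D" "C \<noteq> D" "C \<inter> D \<noteq> {}"
    and cyc: "\<And>X. X \<in> \<C> \<Longrightarrow> X \<subseteq> C \<union> D \<Longrightarrow> X = {} \<or> X = C \<or> X = D \<or> X = sym_diff C D"
    using th by (auto simp: theta_def)
  have fin: "finite C" "finite D" using c circD(1) finite_cycle by auto
  define A B P where "A = C - D" and "B = D - C" and "P = C \<inter> D"
  have parts: "C = A \<union> P" "D = B \<union> P" "sym_diff C D = A \<union> B" and disj: "A \<inter> P = {}" "B \<inter> P = {}" "A \<inter> B = {}"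
    by (auto simp: A_def B_def P_def)
  have finp: "finite A" "finite B" "finite P" using fin by (auto simp: A_def B_def P_def)
  have "card C = card A + card P" "card D = card B + card P"
    using parts disj finp card_Un_disjoint by metis+
  then have oA: "odd (card A)" and oB: "odd (card B)" using odd ev by (auto simp: P_def)
  \<comment> \<open>Being even and nonempty, \<open>P\<close> has at least two elements and splits
    into the odd lengths 1 and \<open>card P - 1\<close>.\<close>
  have "card P \<noteq> 0" using c(4) finp by (simp add: P_def)
  moreover have "even (card P)" using ev by (simp add: P_def)
  ultimately have P2: "odd (card P - 1)" "card P = 1 + (card P - 1)" by auto
  \<comment> \<open>The parallel edges 0 and 3 receive \<open>A\<close> and \<open>B\<close>; edges
    1 and 2 share \<open>P\<close>.\<close>
  define l where "l = (\<lambda>e::nat. [card A, 1, card P - 1, card B] ! e)"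
  have l: "\<forall>e<4. odd (l e)" using oA oB P2 by (auto simp: l_def dest!: less_4_cases)
  define Q where "Q = (\<lambda>e. map (\<lambda>i. prod_encode (e, i)) [0..<l e])"
  define G where "G = sub_graph l"
  note sub = sub_graph_subdivision[OF l, folded Q_def G_def]
  define R where "R = set (Q 1) \<union> set (Q 2)"
  note s = odd_C3_plus_cycles[OF sub(2), folded R_def]
  have len: "length (Q e) = l e" for e by (simp add: Q_def)
  have "card (set (Q 0)) = card A" "card (set (Q 3)) = card B" "card R = card P"
    using s(6)[of 0] s(6)[of 3] s(7) P2 by (simp_all add: len l_def)
  \<comment> \<open>Arbitrary bijections of the three parts work, since dependence is governed by
    which unions of two whole parts a set contains.\<close>
  then obtain a b p where bij: "bij_betw a A (set (Q 0))" "bij_betw b B (set (Q 3))" "bij_betw p P R"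
    using finp by (metis finite_same_card_bij List.finite_set R_def finite_UnI)
  define g where "g x = (if x \<in> A then a x else if x \<in> B then b x else p x)" for x
  have g: "bij_betw g A (set (Q 0))" "bij_betw g B (set (Q 3))" "bij_betw g P R"
  proof -
    have "\<And>x. x \<in> A \<Longrightarrow> g x = a x" "\<And>x. x \<in> B \<Longrightarrow> g x = b x" "\<And>x. x \<in> P \<Longrightarrow> g x = p x"
      using disj by (auto simp: g_def)
    then show "bij_betw g A (set (Q 0))" "bij_betw g B (set (Q 3))" "bij_betw g P R"
      using bij bij_betw_cong[of A g a] bij_betw_cong[of B g b] bij_betw_cong[of P g p] by blast+
  qed
  have gX: "bij_betw g (A \<union> B \<union> P) (edges G)"
    unfolding s(2) using s(3-5) g by (intro bij_betw_combine) auto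
  have im: "g ` A = set (Q 0)" "g ` B = set (Q 3)" "g ` P = R" using g by (auto simp: bij_betw_def)
  have ground: "A \<union> B \<union> P \<subseteq> ground M" using c circD(1) cycle_subset parts by blast
  have sub_iff: "g ` Z \<subseteq> g ` Y \<longleftrightarrow> Z \<subseteq> Y" if "Z \<subseteq> A \<union> B \<union> P" "Y \<subseteq> A \<union> B \<union> P" for Y Z
    using inj_on_image_subset_iff[OF bij_betw_imp_inj_on[OF gX]] that by blast
  have "circ (sym_diff C D)" using theta_sym_diff[OF th] by (simp add: theta_def)
  then have cycles: "A \<union> P \<in> \<C>" "B \<union> P \<in> \<C>" "A \<union> B \<in> \<C>" and nonempty: "A \<union> P \<noteq> {}" "B \<union> P \<noteq> {}" "A \<union> B \<noteq> {}"
    using c circD parts by metis+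
  \<comment> \<open>On both sides independence means containing none of the three unions of two
    parts; \<open>g\<close> carries the one description into the other.\<close>
  have iso: "indep M Y \<longleftrightarrow> g ` Y \<subseteq> edges G \<and> (\<forall>K. K \<subseteq> g ` Y \<longrightarrow> \<not> graph_cycle G K)" if Y: "Y \<subseteq> A \<union> B \<union> P" for Y
  proof -
    have "Z = {} \<or> Z = A \<union> P \<or> Z = B \<union> P \<or> Z = A \<union> B" if "Z \<in> \<C>" "Z \<subseteq> Y" for Z
    proof -
      have "Z \<subseteq> C \<union> D" using that Y by (auto simp: A_def B_def P_def)
      then show ?thesis using cyc[OF that(1)] parts by metis
    qed
    then have "(\<forall>Z\<in>\<C>. Z \<subseteq> Y \<longrightarrow> Z = {}) \<longleftrightarrow> \<not> A \<union> P \<subseteq> Y \<and> \<not> B \<union> P \<subseteq> Y \<and> \<not> A \<union> B \<subseteq> Y"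
      using cycles nonempty by metis
    then have "indep M Y \<longleftrightarrow> \<not> A \<union> P \<subseteq> Y \<and> \<not> B \<union> P \<subseteq> Y \<and> \<not> A \<union> B \<subseteq> Y"
      using indep_iff[OF subset_trans[OF Y ground]] by simp
    also have "\<dots> \<longleftrightarrow> \<not> g ` (A \<union> P) \<subseteq> g ` Y \<and> \<not> g ` (B \<union> P) \<subseteq> g ` Y \<and> \<not> g ` (A \<union> B) \<subseteq> g ` Y"
      using sub_iff[OF _ Y, of "A \<union> P"] sub_iff[OF _ Y, of "B \<union> P"] sub_iff[OF _ Y, of "A \<union> B"] by blast
    also have "\<dots> \<longleftrightarrow> (\<forall>K. K \<subseteq> g ` Y \<longrightarrow> \<not> graph_cycle G K)"
      unfolding s(1) image_Un im by blast
    also have "\<dots> \<longleftrightarrow> g ` Y \<subseteq> edges G \<and> (\<forall>K. K \<subseteq> g ` Y \<longrightarrow> \<not> graph_cycle G K)"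
      using Y gX by (auto simp: bij_betw_def)
    finally show ?thesis .
  qed
  have "matroid_iso (restriction M (A \<union> B \<union> P)) (circuit_matroid G)"
    unfolding matroid_iso_def restriction_def circuit_matroid_def
    using gX iso by (intro exI[of _ g]) simp
  moreover have "odd_C3_plus_graph G"
    unfolding odd_C3_plus_graph_def totally_odd_subdivision_iff using sub by blast
  ultimately show False using free ground unfolding odd_C3_plus_free_def by blast
qed

end

theorem theorem2p12:
  fixes M :: "'a matroid"
  assumes "is_matroid M" and "loopless M"
    and "matroid_connected M" and "\<not> matroid_bipartite M" and "binary M"
  shows "(odd_C3_plus_free M \<longleftrightarrow> (\<exists>B. circuit_basis M B \<and> totally_odd_cycle_basis M B)) \<and>
         ((\<exists>B. circuit_basis M B \<and> totally_odd_cycle_basis M B) \<longleftrightarrow>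
          (\<forall>B. odd_cycle_basis M B \<longrightarrow> totally_odd_cycle_basis M B))"
proof -
  obtain \<C> where "binary_cycles M \<C>" using binary_cycles_exists assms by blast
  then interpret binary_cycles M \<C> .
  obtain C0 where C0: "circ C0" "odd (card C0)"
    using assms(4) by (auto simp: matroid_bipartite_def circuit_iff)
  note conn = conn_ground[OF assms(3)]
  \<comment> \<open>This odd circuit basis exists whether or not \<open>M\<close> is odd-C3+-free.
    It is the witness in (ii) and keeps the quantifier in (iii) from being vacuous.\<close>
  obtain B where B: "circuit_basis M B" "odd_cycle_basis M B"
    using odd_circuit_basis_exists[OF odd_circs_generate(1)[OF conn C0]] by blast
  \<comment> \<open>Each of the three conditions is shown to be equivalent to (P) on the whole
    ground set.\<close>
  have "odd_C3_plus_free M \<longleftrightarrow> parity_form (ground M)"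
    using parity_form_imp_free odd_circs_generate(2)[OF conn C0] free_imp_odd_Int by blast
  moreover have "(\<exists>B. circuit_basis M B \<and> totally_odd_cycle_basis M B) \<longleftrightarrow> parity_form (ground M)"
    using B totally_odd_iff_parity_form unfolding totally_odd_cycle_basis_def by blast
  moreover have "(\<forall>B. odd_cycle_basis M B \<longrightarrow> totally_odd_cycle_basis M B) \<longleftrightarrow> parity_form (ground M)"
    using B totally_odd_iff_parity_form by blast
  ultimately show ?thesis by blast
qed

end
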